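(* Let $\lambda$ be a generic weight of $\mathfrak g$, $\Lambda=k\Lambda_0+\lambda$, $\epsilon=k+h^\vee$. In the critical limit $\epsilon\to0$, the renormalized Whittaker function $$\widehat W_\Lambda^{\widehat\mu,\widehat\mu'}(\widehat\phi)=\sum_{\widehat\beta\in\widehat Q_+}Z_{\widehat\beta}\Big(\prod_{i=0}^r\nu_i^{\beta_i}\Big)e^{(\lambda+\rho-(\beta-\beta_0\theta)\,|\,\phi-\phi_0\theta)}$$ has the asymptotic expansion $$\widehat W_\Lambda^{\widehat\mu,\widehat\mu'}(\widehat\phi)=e^{F/\epsilon}\big(W_0(\widehat\phi)+\epsilon W_1(\widehat\phi)+\epsilon^2W_2(\widehat\phi)+\cdots\big),$$ where $F$ is a power series in the variable $\prod_{i=0}^r\nu_i^{a_i}$, independent of $\widehat\phi$, of the form $$F=\sum_{m\ge1}f_m\Big(\prod_{i=0}^r\nu_i^{a_i}\Big)^m ,$$ and the $W_j(\widehat\phi)$, $j\ge0$, are power series of the form $$W_j(\widehat\phi)=\sum_{\widehat\beta\in\widehat Q_+}\Big(\prod_{i=0}^r\nu_i^{\beta_i}\Big)e^{(\lambda+\rho-(\beta-\beta_0\theta)\,|\,\phi-\phi_0\theta)}\,w_{j;\widehat\beta},$$ with the following properties, where $\widetilde H=\frac12(\nabla_\phi|\nabla_\phi)+\sum_{j=0}^r\nu_je^{-(\alpha_j|\widehat\phi)}$, $\widetilde E_\lambda=E_\lambda+\nu_0\frac{\partial F}{\partial\nu_0}$ and $E_\lambda=\frac12(\lambda+\rho|\lambda+\rho)$: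 (1) $W_0$ is an eigenfunction of the critical affine Toda equation: $\widetilde H\,W_0(\widehat\phi)=\widetilde E_\lambda\,W_0(\widehat\phi)$. (2) For $j\ge1$, $(\widetilde H-\widetilde E_\lambda)\,W_j(\widehat\phi)=\nu_0\frac{\partial W_{j-1}(\widehat\phi)}{\partial\nu_0}$.
   Context: Affine data. $\widehat{\mathfrak g}$ is the non-twisted affine Lie algebra associated with a finite-dimensional simple Lie algebra $\mathfrak g$ of rank $r$, with simple roots $\alpha_0,\dots,\alpha_r$ ($\alpha_1,\dots,\alpha_r$ those of $\mathfrak g$) and Cartan matrix $\widehat C$. The positive numbers $d_i$ satisfy $\widehat C_{i,j}d_j=\widehat C_{j,i}d_i$ and $d_0=1$; $\alpha_i=d_i\alpha_i^\vee$; the symmetric bilinear form satisfies $(\alpha_i|\alpha_j^\vee)=\widehat C_{i,j}$. $\theta=\sum_{i=1}^ra_i\alpha_i$ is the highest root of $\mathfrak g$, $a_0=1$, $\delta=\alpha_0+\theta=\sum_{i=0}^ra_i\alpha_i$; the co-marks are $a_i^\vee=d_ia_i$ and $h^\vee=\sum_{i=0}^ra_i^\vee$ is the dual Coxeter number. $(\delta|\alpha_i)=(\delta|\delta)=0$, $(\Lambda_0|\alpha_j^\vee)=\delta_{j,0}$, $(\Lambda_0|\delta)=1$, $(\Lambda_0|\Lambda_0)=0$; $\omega_1,\dots,\omega_r$ are the fundamental weights of $\mathfrak g$ ($(\omega_i|\alpha_j^\vee)=\delta_{i,j}$ for $1\le i,j\le r$), orthogonal to $\delta,\Lambda_0$;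 $\rho=\sum_{i=1}^r\omega_i$; $\widehat\rho=h^\vee\Lambda_0+\rho$. $\widehat Q_+=\bigoplus_{i=0}^r\mathbb Z_{\ge0}\alpha_i$; for $\widehat\beta=\sum_{i=0}^r\beta_i\alpha_i$ write $\beta=\sum_{i=1}^r\beta_i\alpha_i$, so $\widehat\beta=\beta_0\delta+(\beta-\beta_0\theta)$. Variables. $\widehat\phi=\sum_{i=0}^r\phi_i\alpha_i^\vee$, $\phi=\sum_{i=1}^r\phi_i\alpha_i^\vee$, $\nabla_\phi=\sum_{i=1}^r\frac{\partial}{\partial\phi_i}\omega_i$, so $(\nabla_\phi|\nabla_\phi)=\sum_{i,j=1}^r(\omega_i|\omega_j)\frac{\partial^2}{\partial\phi_i\partial\phi_j}$. $\nu_i=d_i\mu_i\mu_i'$, $0\le i\le r$, where $\widehat\mu,\widehat\mu'\in(\mathbb C^* )^{r+1}$; the $\nu_i$ are used as expansion variables. Whittaker function. For non-critical level, $\mathcal P_{\widehat\beta}$ is the set of sequences $\mathbf p=(p_0,\dots,p_N)$ in $\widehat Q_+$ with $p_0=0$, $p_N=\widehat\beta$ and each $p_k-p_{k-1}\in\{\alpha_0,\dots,\alpha_r\}$, and $Z_{\widehat\beta}=\sum_{\mathbf p\in\mathcal P_{\widehat\beta}}\prod_{k=1}^N\frac1{\widehat v(p_k)}$ with $\widehat v(\widehat\beta)=(\Lambda+\widehat\rho|\widehat\beta)-\frac12(\widehat\beta|\widehat\beta)=\epsilon\beta_0+(\lambda+\rho|\beta-\beta_0\theta)-\frac12(\beta-\beta_0\theta|\beta-\beta_0\theta)$;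 thus $Z_{\widehat\beta}$ is a rational function of $\epsilon$. The renormalized Whittaker function is $e^{-\epsilon\phi_0}$ times the modified Whittaker function $\sum_{\widehat\beta}Z_{\widehat\beta}\prod_i\nu_i^{\beta_i}e^{(\Lambda+\widehat\rho-\widehat\beta|\widehat\phi)}$, and equals the series displayed in the claim. Conventions. The expansion is understood as an identity of formal power series in $\nu_0,\dots,\nu_r$, the coefficient of each monomial being expanded in Laurent series at $\epsilon=0$; the coefficients $f_m$ and $w_{j;\widehat\beta}$ are complex numbers depending on $\lambda$ but not on $\epsilon$, the $\nu_i$ or $\widehat\phi$. "$\lambda$ generic" means $(\lambda+\rho|\gamma)-\frac12(\gamma|\gamma)\neq0$ for every nonzero $\gamma$ in the root lattice of $\mathfrak g$. *)

theory Defs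
  imports "HOL-Library.Function_Algebras" "HOL-Complex_Analysis.Complex_Analysis"
begin

section \<open>Formal power series in finitely many variables\<close>

text \<open>
  A formal power series in variables \<open>\<nu>\<^sub>i\<close> (\<open>i :: 'i\<close>) is the family of its coefficients.
  Addition and subtraction are the pointwise ones of \<^theory>\<open>HOL-Library.Function_Algebras\<close>;
  the product of series is \<open>mps_mult\<close>, not the pointwise \<open>*\<close>.
\<close>

type_synonym ('i, 'a) mps = "('i \<Rightarrow> nat) \<Rightarrow> 'a"

definition mps_mult :: "('i::finite, 'a::comm_semiring_1) mps \<Rightarrow> ('i, 'a) mps \<Rightarrow> ('i, 'a) mps" where
  "mps_mult F G = (\<lambda>\<beta>. \<Sum>\<gamma> | \<gamma> \<le> \<beta>. F \<gamma> * G (\<beta> - \<gamma>))"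

definition mps_monom :: "('i \<Rightarrow> nat) \<Rightarrow> 'a::zero \<Rightarrow> ('i, 'a) mps" where
  "mps_monom \<beta> c = (\<lambda>\<gamma>. if \<gamma> = \<beta> then c else 0)"

primrec mps_power :: "('i::finite, 'a::comm_semiring_1) mps \<Rightarrow> nat \<Rightarrow> ('i, 'a) mps" where
  "mps_power F 0 = mps_monom 0 1"
| "mps_power F (Suc n) = mps_mult F (mps_power F n)"

text \<open>
  The exponential series \<open>\<Sum>\<^sub>n F\<^sup>n / n!\<close>, for \<open>F\<close> without constant term: then \<open>F\<^sup>n\<close> has no term of
  total degree less than \<open>n\<close>, so that only \<open>n \<le> |\<beta>|\<close> contributes to the coefficient at \<open>\<beta>\<close>.
\<close>

definition mps_exp :: "('i::finite, 'a::field_char_0) mps \<Rightarrow> ('i, 'a) mps" where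
  "mps_exp F = (\<lambda>\<beta>. \<Sum>n\<le>(\<Sum>i\<in>UNIV. \<beta> i). mps_power F n \<beta> / fact n)"

text \<open>The Euler operator \<open>\<nu>\<^sub>i \<partial>/\<partial>\<nu>\<^sub>i\<close>.\<close>

definition mps_euler :: "'i \<Rightarrow> ('i, 'a::comm_semiring_1) mps \<Rightarrow> ('i, 'a) mps" where
  "mps_euler i F = (\<lambda>\<beta>. of_nat (\<beta> i) * F \<beta>)"

definition unit_exp :: "'i \<Rightarrow> 'i \<Rightarrow> nat" where
  "unit_exp i = (\<lambda>j. if j = i then 1 else 0)"


section \<open>Simple Lie algebras and their roots\<close>

locale simple_lie_algebra = vector_space scale
  for scale :: "complex \<Rightarrow> 'g::ab_group_add \<Rightarrow> 'g" +
  fixes lie :: "'g \<Rightarrow> 'g \<Rightarrow> 'g"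
  assumes finite_dim: "\<exists>B. finite B \<and> span B = UNIV"
    and lie_linear_right: "Vector_Spaces.linear scale scale (lie x)"
    and lie_linear_left: "Vector_Spaces.linear scale scale (\<lambda>x. lie x y)"
    and lie_self: "lie x x = 0"
    and jacobi: "lie x (lie y z) + lie y (lie z x) + lie z (lie x y) = 0"
    and non_abelian: "\<exists>x y. lie x y \<noteq> 0"
    and simple: "subspace I \<Longrightarrow> (\<And>x y. y \<in> I \<Longrightarrow> lie x y \<in> I) \<Longrightarrow> I = {0} \<or> I = UNIV"

type_synonym 'g weight = "'g \<Rightarrow> complex"

text \<open>
  The index type \<open>'n\<close> has \<open>r\<close> elements and labels the simple roots of \<open>\<gg>\<close>; affine indices
  \<open>0, \<dots>, r\<close> are elements of \<open>'n option\<close>, with \<open>None\<close> playing the role of \<open>0\<close>.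
\<close>

record ('g, 'n) affine_data =
  scl :: "complex \<Rightarrow> 'g \<Rightarrow> 'g"                      \<comment> \<open>scalar multiplication of \<open>\<gg>\<close>\<close>
  bracket :: "'g \<Rightarrow> 'g \<Rightarrow> 'g"
  csa :: "'g set"                                  \<comment> \<open>Cartan subalgebra\<close>
  sroot :: "'n \<Rightarrow> 'g weight"                      \<comment> \<open>simple roots \<open>\<alpha>\<^sub>1, \<dots>, \<alpha>\<^sub>r\<close>\<close>
  mark :: "'n option \<Rightarrow> nat"                      \<comment> \<open>\<open>a\<^sub>i\<close>\<close>
  symm :: "'n option \<Rightarrow> real"                     \<comment> \<open>\<open>d\<^sub>i\<close>\<close>
  bform :: "'g weight \<Rightarrow> 'g weight \<Rightarrow> complex"      \<comment> \<open>bilinear form on the dual of \<open>csa\<close>\<close>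
  fweight :: "'n \<Rightarrow> 'g weight"                    \<comment> \<open>\<open>\<omega>\<^sub>1, \<dots>, \<omega>\<^sub>r\<close>\<close>

definition wscale :: "complex \<Rightarrow> 'g weight \<Rightarrow> 'g weight" where
  "wscale c f = (\<lambda>x. c * f x)"

text \<open>
  Linear functionals on the Cartan subalgebra, made canonical as functions on \<open>\<gg>\<close> by
  the value \<open>0\<close> outside of it.
\<close>

definition weights :: "('g::ab_group_add, 'n, 'm) affine_data_scheme \<Rightarrow> 'g weight set" where
  "weights D = {f. (\<forall>x\<in>csa D. \<forall>y\<in>csa D. f (x + y) = f x + f y) \<and>
                   (\<forall>c. \<forall>x\<in>csa D. f (scl D c x) = c * f x) \<and>
                   (\<forall>x. x \<notin> csa D \<longrightarrow> f x = 0)}"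

primrec lower_central ::
    "('g::ab_group_add, 'n, 'm) affine_data_scheme \<Rightarrow> nat \<Rightarrow> 'g set" where
  "lower_central D 0 = csa D"
| "lower_central D (Suc n) =
     module.span (scl D) {bracket D x y |x y. x \<in> csa D \<and> y \<in> lower_central D n}"

definition cartan_subalgebra :: "('g::ab_group_add, 'n, 'm) affine_data_scheme \<Rightarrow> bool" where
  "cartan_subalgebra D \<longleftrightarrow>
     module.subspace (scl D) (csa D) \<and>
     (\<forall>x\<in>csa D. \<forall>y\<in>csa D. bracket D x y \<in> csa D) \<and>
     (\<exists>n. lower_central D n = {0}) \<and>
     {x. \<forall>y\<in>csa D. bracket D x y \<in> csa D} = csa D"

definition root_space ::
    "('g::ab_group_add, 'n, 'm) affine_data_scheme \<Rightarrow> 'g weight \<Rightarrow> 'g set" where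
  "root_space D \<alpha> = {x. \<forall>h\<in>csa D. bracket D h x = scl D (\<alpha> h) x}"

definition roots :: "('g::ab_group_add, 'n, 'm) affine_data_scheme \<Rightarrow> 'g weight set" where
  "roots D = {\<alpha> \<in> weights D. \<alpha> \<noteq> 0 \<and> root_space D \<alpha> \<noteq> {0}}"

definition coroot :: "('g::ab_group_add, 'n, 'm) affine_data_scheme \<Rightarrow> 'g weight \<Rightarrow> 'g" where
  "coroot D \<alpha> = (THE h. h \<in> module.span (scl D)
      {bracket D x y |x y. x \<in> root_space D \<alpha> \<and> y \<in> root_space D (- \<alpha>)} \<and> \<alpha> h = 2)"

definition simple_roots ::
    "('g::ab_group_add, 'n::finite, 'm) affine_data_scheme \<Rightarrow> bool" where
  "simple_roots D \<longleftrightarrow>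
     (\<forall>i. sroot D i \<in> roots D) \<and>
     (\<forall>f\<in>weights D. \<exists>!c. f = (\<Sum>i\<in>UNIV. wscale (c i) (sroot D i))) \<and>
     (\<forall>\<beta>\<in>roots D. \<exists>n::'n \<Rightarrow> nat.
        \<beta> = (\<Sum>i\<in>UNIV. wscale (of_nat (n i)) (sroot D i)) \<or>
        - \<beta> = (\<Sum>i\<in>UNIV. wscale (of_nat (n i)) (sroot D i)))"

definition theta :: "('g, 'n::finite, 'm) affine_data_scheme \<Rightarrow> 'g weight" where
  "theta D = (\<Sum>i\<in>UNIV. wscale (of_nat (mark D (Some i))) (sroot D i))"

definition highest_root ::
    "('g::ab_group_add, 'n::finite, 'm) affine_data_scheme \<Rightarrow> 'g weight \<Rightarrow> bool" where
  "highest_root D \<theta> \<longleftrightarrow> \<theta> \<in> roots D \<and>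
     (\<forall>\<beta>\<in>roots D. \<exists>n::'n \<Rightarrow> nat. \<theta> - \<beta> = (\<Sum>i\<in>UNIV. wscale (of_nat (n i)) (sroot D i)))"


section \<open>Affine weights\<close>

text \<open>
  \<open>(x, m, l)\<close> stands for \<open>x + m \<delta> + l \<Lambda>\<^sub>0\<close>, with \<open>x\<close> a weight of \<open>\<gg>\<close>.
\<close>

type_synonym 'g aweight = "'g weight \<times> complex \<times> complex"

definition awscale :: "complex \<Rightarrow> 'g aweight \<Rightarrow> 'g aweight" where
  "awscale c = (\<lambda>(x, m, l). (wscale c x, c * m, c * l))"

definition fin_wt :: "'g weight \<Rightarrow> 'g aweight" where
  "fin_wt x = (x, 0, 0)"

definition delta :: "'g aweight" where
  "delta = (0, 1, 0)"

definition Lambda0 :: "'g aweight" where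
  "Lambda0 = (0, 0, 1)"

definition aform :: "('g, 'n, 'm) affine_data_scheme \<Rightarrow> 'g aweight \<Rightarrow> 'g aweight \<Rightarrow> complex" where
  "aform D = (\<lambda>(x, m, l) (x', m', l'). bform D x x' + m * l' + l * m')"

definition asroot :: "('g, 'n::finite, 'm) affine_data_scheme \<Rightarrow> 'n option \<Rightarrow> 'g aweight" where
  "asroot D i = (case i of None \<Rightarrow> delta - fin_wt (theta D) | Some j \<Rightarrow> fin_wt (sroot D j))"

definition ascoroot :: "('g, 'n::finite, 'm) affine_data_scheme \<Rightarrow> 'n option \<Rightarrow> 'g aweight" where
  "ascoroot D i = awscale (1 / of_real (symm D i)) (asroot D i)"

text \<open>
  The coroot of \<open>\<alpha>\<^sub>0\<close> in the affine algebra is the coroot of the root \<open>- \<theta>\<close> of \<open>\<gg>\<close> plus a central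
  element, and \<open>\<delta>\<close> vanishes on the Cartan subalgebra of \<open>\<gg>\<close>.  As the \<open>\<alpha>\<^sub>i\<close> vanish on the centre,
  the affine Cartan matrix is that of \<open>- \<theta>, \<alpha>\<^sub>1, \<dots>, \<alpha>\<^sub>r\<close> and their coroots in \<open>\<gg>\<close>.
\<close>

definition gradient :: "('g, 'n::finite, 'm) affine_data_scheme \<Rightarrow> 'n option \<Rightarrow> 'g weight" where
  "gradient D i = (case i of None \<Rightarrow> - theta D | Some j \<Rightarrow> sroot D j)"

definition acartan ::
    "('g::ab_group_add, 'n::finite, 'm) affine_data_scheme \<Rightarrow> 'n option \<Rightarrow> 'n option \<Rightarrow> complex" where
  "acartan D i j = gradient D i (coroot D (gradient D j))"

locale affine_data =
  fixes D :: "('g::ab_group_add, 'n::finite) affine_data"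
  assumes simple_lie: "simple_lie_algebra (scl D) (bracket D)"
    and cartan: "cartan_subalgebra D"
    and simple_roots: "simple_roots D"
    and mark_0: "mark D None = 1"
    and highest_root: "highest_root D (theta D)"
    and symm_pos: "symm D i > 0"
    and symm_0: "symm D None = 1"
    and symm_cartan: "acartan D i j * of_real (symm D j) = acartan D j i * of_real (symm D i)"
    and bform_sym: "x \<in> weights D \<Longrightarrow> y \<in> weights D \<Longrightarrow> bform D x y = bform D y x"
    and bform_add: "x \<in> weights D \<Longrightarrow> y \<in> weights D \<Longrightarrow> z \<in> weights D \<Longrightarrow>
      bform D (x + y) z = bform D x z + bform D y z"
    and bform_scale: "x \<in> weights D \<Longrightarrow> y \<in> weights D \<Longrightarrow>
      bform D (wscale c x) y = c * bform D x y"
    and bform_cartan: "aform D (asroot D i) (ascoroot D j) = acartan D i j"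
    and fweight_in: "fweight D p \<in> weights D"
    and fweight_dual: "aform D (fin_wt (fweight D p)) (ascoroot D (Some q)) = (if p = q then 1 else 0)"

definition dual_coxeter :: "('g, 'n::finite, 'm) affine_data_scheme \<Rightarrow> real" where
  "dual_coxeter D = (\<Sum>i\<in>UNIV. symm D i * of_nat (mark D i))"

definition rho :: "('g, 'n::finite, 'm) affine_data_scheme \<Rightarrow> 'g weight" where
  "rho D = (\<Sum>i\<in>UNIV. fweight D i)"

definition rho_hat :: "('g, 'n::finite, 'm) affine_data_scheme \<Rightarrow> 'g aweight" where
  "rho_hat D = awscale (of_real (dual_coxeter D)) Lambda0 + fin_wt (rho D)"

definition generic :: "('g, 'n::finite, 'm) affine_data_scheme \<Rightarrow> 'g weight \<Rightarrow> bool" where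
  "generic D lam \<longleftrightarrow> (\<forall>n::'n \<Rightarrow> int. \<forall>\<gamma>. \<gamma> = (\<Sum>i\<in>UNIV. wscale (of_int (n i)) (sroot D i)) \<longrightarrow>
     \<gamma> \<noteq> 0 \<longrightarrow> bform D (lam + rho D) \<gamma> - 1/2 * bform D \<gamma> \<gamma> \<noteq> 0)"


section \<open>The Whittaker function\<close>

text \<open>
  An element \<open>\<Sum>\<^sub>i \<beta>\<^sub>i \<alpha>\<^sub>i\<close> of the positive affine root cone is represented by its coefficients \<open>\<beta>\<close>.
\<close>

definition cone_wt ::
    "('g, 'n::finite, 'm) affine_data_scheme \<Rightarrow> ('n option \<Rightarrow> nat) \<Rightarrow> 'g aweight" where
  "cone_wt D \<beta> = (\<Sum>i\<in>UNIV. awscale (of_nat (\<beta> i)) (asroot D i))"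

text \<open>The element \<open>\<beta> - \<beta>\<^sub>0 \<theta>\<close> of the root lattice of \<open>\<gg>\<close>.\<close>

definition cone_fin ::
    "('g, 'n::finite, 'm) affine_data_scheme \<Rightarrow> ('n option \<Rightarrow> nat) \<Rightarrow> 'g weight" where
  "cone_fin D \<beta> = (\<Sum>i\<in>UNIV. wscale (of_nat (\<beta> (Some i))) (sroot D i))
     - wscale (of_nat (\<beta> None)) (theta D)"

definition v_hat :: "('g, 'n::finite, 'm) affine_data_scheme \<Rightarrow> 'g aweight \<Rightarrow>
    ('n option \<Rightarrow> nat) \<Rightarrow> complex" where
  "v_hat D \<Lambda> \<beta> = aform D (\<Lambda> + rho_hat D) (cone_wt D \<beta>)
     - 1/2 * aform D (cone_wt D \<beta>) (cone_wt D \<beta>)"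

definition root_paths :: "('i \<Rightarrow> nat) \<Rightarrow> ('i \<Rightarrow> nat) list set" where
  "root_paths \<beta> = {p. p \<noteq> [] \<and> hd p = 0 \<and> last p = \<beta> \<and>
     (\<forall>k. Suc k < length p \<longrightarrow> (\<exists>i. p ! Suc k = p ! k + unit_exp i))}"

definition Z_coeff :: "('g, 'n::finite, 'm) affine_data_scheme \<Rightarrow> 'g aweight \<Rightarrow>
    ('n option \<Rightarrow> nat) \<Rightarrow> complex" where
  "Z_coeff D \<Lambda> \<beta> = (\<Sum>p\<in>root_paths \<beta>. \<Prod>k\<in>{1..<length p}. 1 / v_hat D \<Lambda> (p ! k))"

text \<open>
  The variable \<open>\<Sum>\<^sub>i \<phi>\<^sub>i \<alpha>\<^sub>i\<^sup>\<or>\<close> is represented by \<open>\<phi> :: 'n option \<Rightarrow> complex\<close>; \<open>phi_fin D \<phi>\<close> is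
  \<open>\<phi> - \<phi>\<^sub>0 \<theta>\<close>.
\<close>

definition phi_hat ::
    "('g, 'n::finite, 'm) affine_data_scheme \<Rightarrow> ('n option \<Rightarrow> complex) \<Rightarrow> 'g aweight" where
  "phi_hat D \<phi> = (\<Sum>i\<in>UNIV. awscale (\<phi> i) (ascoroot D i))"

definition phi_fin ::
    "('g, 'n::finite, 'm) affine_data_scheme \<Rightarrow> ('n option \<Rightarrow> complex) \<Rightarrow> 'g weight" where
  "phi_fin D \<phi> = (\<Sum>i\<in>UNIV. wscale (\<phi> (Some i) / of_real (symm D (Some i))) (sroot D i))
     - wscale (\<phi> None) (theta D)"

definition wexp :: "('g, 'n::finite, 'm) affine_data_scheme \<Rightarrow> 'g weight \<Rightarrow>
    ('n option \<Rightarrow> complex) \<Rightarrow> ('n option \<Rightarrow> nat) \<Rightarrow> complex" where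
  "wexp D lam \<phi> \<beta> = exp (bform D (lam + rho D - cone_fin D \<beta>) (phi_fin D \<phi>))"

text \<open>The renormalized Whittaker function for \<open>\<Lambda> = k \<Lambda>\<^sub>0 + \<lambda>\<close>, as a power series in the \<open>\<nu>\<^sub>i\<close>.\<close>

definition whittaker :: "('g, 'n::finite, 'm) affine_data_scheme \<Rightarrow> 'g weight \<Rightarrow> complex \<Rightarrow>
    ('n option \<Rightarrow> complex) \<Rightarrow> ('n option, complex) mps" where
  "whittaker D lam k \<phi> = (\<lambda>\<beta>. Z_coeff D (awscale k Lambda0 + fin_wt lam) \<beta> * wexp D lam \<phi> \<beta>)"


section \<open>The expansion and the Toda operator\<close>

text \<open>
  \<open>F = \<Sum>\<^sub>m\<^sub>\<ge>\<^sub>1 f\<^sub>m (\<Prod>\<^sub>i \<nu>\<^sub>i\<^bsup>a\<^sub>i\<^esup>)\<^sup>m\<close>; the sum below has at most one term.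
\<close>

definition F_series ::
    "('g, 'n, 'm) affine_data_scheme \<Rightarrow> (nat \<Rightarrow> complex) \<Rightarrow> ('n option, complex) mps" where
  "F_series D f = (\<lambda>\<beta>. \<Sum>m | 1 \<le> m \<and> \<beta> = (\<lambda>i. m * mark D i). f m)"

definition W_series :: "('g, 'n::finite, 'm) affine_data_scheme \<Rightarrow> 'g weight \<Rightarrow>
    (('n option \<Rightarrow> nat) \<Rightarrow> complex) \<Rightarrow> ('n option \<Rightarrow> complex) \<Rightarrow> ('n option, complex) mps" where
  "W_series D lam w \<phi> = (\<lambda>\<beta>. wexp D lam \<phi> \<beta> * w \<beta>)"

definition div_eps :: "('i, complex) mps \<Rightarrow> ('i, complex fls) mps" where
  "div_eps F = (\<lambda>\<beta>. fls_const (F \<beta>) / fls_X)"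

text \<open>\<open>\<Sum>\<^sub>j \<epsilon>\<^sup>j U\<^sub>j\<close>.\<close>

definition eps_series :: "(nat \<Rightarrow> ('i, complex) mps) \<Rightarrow> ('i, complex fls) mps" where
  "eps_series U = (\<lambda>\<beta>. fps_to_fls (Abs_fps (\<lambda>j. U j \<beta>)))"

definition phi_deriv :: "'n \<Rightarrow> (('n option \<Rightarrow> complex) \<Rightarrow> complex) \<Rightarrow> ('n option \<Rightarrow> complex) \<Rightarrow> complex" where
  "phi_deriv i u \<phi> = deriv (\<lambda>t. u (\<phi>(Some i := t))) (\<phi> (Some i))"

text \<open>
  The operator \<open>1/2 (\<nabla>\<^sub>\<phi>|\<nabla>\<^sub>\<phi>) + \<Sum>\<^sub>j \<nu>\<^sub>j exp (-(\<alpha>\<^sub>j|phi_hat D \<phi>))\<close>, acting on power series in the \<open>\<nu>\<^sub>i\<close> whose coefficients are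
  functions of \<open>\<phi>\<close>.
\<close>

definition toda :: "('g, 'n::finite, 'm) affine_data_scheme \<Rightarrow>
    (('n option \<Rightarrow> complex) \<Rightarrow> ('n option, complex) mps) \<Rightarrow>
    ('n option \<Rightarrow> complex) \<Rightarrow> ('n option, complex) mps" where
  "toda D U \<phi> =
     (\<lambda>\<beta>. 1/2 * (\<Sum>i\<in>UNIV. \<Sum>j\<in>UNIV. bform D (fweight D i) (fweight D j) *
              phi_deriv i (phi_deriv j (\<lambda>\<psi>. U \<psi> \<beta>)) \<phi>))
     + (\<Sum>j\<in>UNIV. mps_mult (mps_monom (unit_exp j) (exp (- aform D (asroot D j) (phi_hat D \<phi>)))) (U \<phi>))"

definition E_eigen :: "('g, 'n::finite, 'm) affine_data_scheme \<Rightarrow> 'g weight \<Rightarrow> complex" where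
  "E_eigen D lam = 1/2 * bform D (lam + rho D) (lam + rho D)"

text \<open>\<open>E\<^sub>\<lambda> + \<nu>\<^sub>0 \<partial>F/\<partial>\<nu>\<^sub>0\<close>.\<close>

definition E_tilde :: "('g, 'n::finite, 'm) affine_data_scheme \<Rightarrow> 'g weight \<Rightarrow>
    (nat \<Rightarrow> complex) \<Rightarrow> ('n option, complex) mps" where
  "E_tilde D lam f = mps_monom 0 (E_eigen D lam) + mps_euler None (F_series D f)"

end

theory Submission
  imports Defs
begin

text \<open>
  Removing the last step of a path gives \<open>(c \<beta> + \<epsilon> \<beta>\<^sub>0) Z\<^sub>\<beta> = \<Sum>\<^sub>i Z\<^bsub>\<beta> - \<alpha>\<^sub>i\<^esub>\<close>, and by genericity \<open>c \<beta>\<close> vanishes only for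
  \<open>\<beta>\<close> a multiple of \<open>\<delta>\<close>, where the coefficient has a simple zero at \<open>\<epsilon> = 0\<close>.
  Inserting \<open>Z = e\<^bsup>F/\<epsilon>\<^esup> W\<close> with \<open>F\<close> a series in \<open>\<Prod>\<^sub>i \<nu>\<^sub>i\<^bsup>a\<^sub>i\<^esup>\<close> replaces the recursion by
  \<open>(c + \<epsilon> \<nu>\<^sub>0 \<partial>/\<partial>\<nu>\<^sub>0 + \<nu>\<^sub>0 \<partial>F/\<partial>\<nu>\<^sub>0) W = (\<Sum>\<^sub>i \<nu>\<^sub>i) W\<close>, because \<open>c\<close> is invariant under \<open>\<beta> \<mapsto> \<beta> + \<delta>\<close>.
  This has a solution \<open>W\<close> regular at \<open>\<epsilon> = 0\<close>: at \<open>\<beta> = n \<delta>\<close> the coefficient \<open>f\<^sub>n\<close> of \<open>F\<close> is chosen to make the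
  equation divisible by \<open>\<epsilon>\<close>.  The recursion determines \<open>Z\<close>, so \<open>e\<^bsup>F/\<epsilon>\<^esup> W\<close> is its Laurent expansion, and the
  coefficients of \<open>\<epsilon>\<^sup>j\<close> in the equation for \<open>W\<close> are the asserted Toda equations, since
  \<open>e\<^bsup>(x|\<phi>)\<^esup>\<close> with \<open>x = \<lambda> + \<rho> - \<gamma>\<close> has Laplace eigenvalue \<open>1/2 (x|x) = E\<^sub>\<lambda> - c \<beta>\<close>, where \<open>\<gamma> = \<beta> - \<beta>\<^sub>0 \<theta>\<close>.
\<close>

section \<open>Power series in finitely many variables\<close>

lemma fun_diff_diff_cancel:
  fixes \<beta> \<gamma> :: "'i \<Rightarrow> nat"
  shows "\<gamma> \<le> \<beta> \<Longrightarrow> \<beta> - (\<beta> - \<gamma>) = \<gamma>"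
  by (auto simp: le_fun_def)

lemma fun_diff_le: "\<beta> - \<gamma> \<le> (\<beta> :: 'i \<Rightarrow> nat)"
  by (auto simp: le_fun_def)

lemma finite_atMost_fun: "finite {\<gamma>. \<gamma> \<le> (\<beta> :: 'i::finite \<Rightarrow> nat)}"
proof -
  have "{\<gamma>. \<gamma> \<le> \<beta>} = PiE UNIV (\<lambda>i. {..\<beta> i})"
    by (auto simp: PiE_def le_fun_def)
  then show ?thesis
    by (simp add: finite_PiE)
qed

text \<open>Makes the total degree a measure for the recursions over exponents below.\<close>

lemma sum_size_diff_less:
  fixes \<beta> \<gamma> :: "'i::finite \<Rightarrow> nat"
  assumes "\<gamma> \<le> \<beta>" "\<gamma> \<noteq> 0"
  shows "(\<Sum>i\<in>UNIV. (\<beta> - \<gamma>) i) < (\<Sum>i\<in>UNIV. \<beta> i)"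
proof -
  obtain i where "\<gamma> i \<noteq> 0"
    using assms(2) by (auto simp: fun_eq_iff)
  with assms(1) show ?thesis
    by (intro sum_strict_mono_ex1) (auto simp: le_fun_def intro!: exI[of _ i] diff_less intro: order_less_le_trans)
qed

lemma unit_exp_le_iff: "unit_exp i \<le> \<beta> \<longleftrightarrow> 0 < \<beta> i"
  by (auto simp: le_fun_def unit_exp_def)

lemma unit_exp_neq_0: "unit_exp i \<noteq> 0"
  by (auto simp: unit_exp_def fun_eq_iff)

section \<open>The convolution product of power series\<close>

lemma mps_mult_comm: "mps_mult F G = mps_mult G F"
proof
  fix \<beta>
  show "mps_mult F G \<beta> = mps_mult G F \<beta>"
    unfolding mps_mult_def
    by (rule sum.reindex_bij_witness[of _ "\<lambda>\<gamma>. \<beta> - \<gamma>" "\<lambda>\<gamma>. \<beta> - \<gamma>"])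
      (simp_all add: fun_diff_diff_cancel fun_diff_le mult.commute)
qed

text \<open>Both sides sum over the splittings of \<open>\<beta>\<close> into three exponents; only
  the grouping changes.\<close>

lemma mps_mult_assoc: "mps_mult (mps_mult F G) H = mps_mult F (mps_mult G H)"
proof
  fix \<beta>
  have "mps_mult (mps_mult F G) H \<beta> =
      (\<Sum>(\<gamma>, \<delta>)\<in>(SIGMA \<gamma>:{\<gamma>. \<gamma> \<le> \<beta>}. {\<delta>. \<delta> \<le> \<gamma>}). F \<delta> * G (\<gamma> - \<delta>) * H (\<beta> - \<gamma>))"
    by (simp add: mps_mult_def sum_distrib_right sum.Sigma finite_atMost_fun)
  also have "\<dots> = (\<Sum>(\<delta>, \<kappa>)\<in>(SIGMA \<delta>:{\<delta>. \<delta> \<le> \<beta>}. {\<kappa>. \<kappa> \<le> \<beta> - \<delta>}).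
      F \<delta> * (G \<kappa> * H (\<beta> - \<delta> - \<kappa>)))"
    by (rule sum.reindex_bij_witness[of _ "\<lambda>(\<delta>, \<kappa>). (\<delta> + \<kappa>, \<delta>)" "\<lambda>(\<gamma>, \<delta>). (\<delta>, \<gamma> - \<delta>)"])
      (auto simp: le_fun_def fun_eq_iff fun_diff_def mult.assoc plus_fun_def
         intro: order_trans diff_le_mono add_leD1
         intro!: arg_cong[where f = H] arg_cong[where f = G] arg_cong2[where f = "(*)"]
         simp: le_diff_conv2 le_diff_conv add.commute)
  also have "\<dots> = mps_mult F (mps_mult G H) \<beta>"
    by (simp add: mps_mult_def sum_distrib_left sum.Sigma finite_atMost_fun)
  finally show "mps_mult (mps_mult F G) H \<beta> = mps_mult F (mps_mult G H) \<beta>" .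
qed

lemma mps_mult_left_commute: "mps_mult F (mps_mult G H) = mps_mult G (mps_mult F H)"
  by (metis mps_mult_assoc mps_mult_comm)

lemma mps_mult_add_left: "mps_mult (F + G) H \<beta> = mps_mult F H \<beta> + mps_mult G H \<beta>"
  by (simp add: mps_mult_def distrib_right sum.distrib)

lemma mps_mult_add_right: "mps_mult F (\<lambda>\<beta>. G \<beta> + H \<beta>) \<beta> = mps_mult F G \<beta> + mps_mult F H \<beta>"
  by (simp add: mps_mult_def distrib_left sum.distrib)

lemma mps_mult_sum_right: "mps_mult F (\<lambda>\<beta>. \<Sum>i\<in>I. G i \<beta>) \<beta> = (\<Sum>i\<in>I. mps_mult F (G i) \<beta>)"
  unfolding mps_mult_def sum_distrib_left by (rule sum.swap)

lemma mps_mult_monom_left: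
  "mps_mult (mps_monom \<gamma> c) G \<beta> = (if \<gamma> \<le> \<beta> then c * G (\<beta> - \<gamma>) else 0)"
proof -
  have "mps_mult (mps_monom \<gamma> c) G \<beta> = (\<Sum>\<delta> | \<delta> \<le> \<beta>. if \<delta> = \<gamma> then c * G (\<beta> - \<gamma>) else 0)"
    unfolding mps_mult_def mps_monom_def by (rule sum.cong) auto
  then show ?thesis
    by (simp add: finite_atMost_fun)
qed

lemma mps_mult_zero_exp: "mps_mult F G 0 = F 0 * G 0"
proof -
  have "{\<gamma>::'i\<Rightarrow>nat. \<gamma> \<le> 0} = {0}"
    by (auto simp: le_fun_def fun_eq_iff)
  then show ?thesis
    by (simp add: mps_mult_def)
qed

section \<open>The Euler derivation and the exponential series\<close>

lemma mps_euler_mult: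
  "mps_euler i (mps_mult F G) \<beta> = mps_mult (mps_euler i F) G \<beta> + mps_mult F (mps_euler i G) \<beta>"
  unfolding mps_euler_def mps_mult_def sum_distrib_left sum.distrib[symmetric]
proof (rule sum.cong)
  fix \<gamma> assume "\<gamma> \<in> {\<gamma>. \<gamma> \<le> \<beta>}"
  then have "\<beta> i = \<gamma> i + (\<beta> - \<gamma>) i"
    by (auto simp: le_fun_def)
  then show "of_nat (\<beta> i) * (F \<gamma> * G (\<beta> - \<gamma>)) =
      of_nat (\<gamma> i) * F \<gamma> * G (\<beta> - \<gamma>) + F \<gamma> * (of_nat ((\<beta> - \<gamma>) i) * G (\<beta> - \<gamma>))"
    by (simp only: of_nat_add) (simp add: algebra_simps)
qed simp

lemma mps_euler_power:
  "mps_euler i (mps_power F (Suc n)) \<beta> = of_nat (Suc n) * mps_mult (mps_euler i F) (mps_power F n) \<beta>"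
proof (induction n arbitrary: \<beta>)
  case 0
  have "mps_euler i (mps_monom 0 1) = (\<lambda>_. 0 :: 'a)"
    by (auto simp: mps_euler_def mps_monom_def fun_eq_iff)
  then show ?case
    by (simp add: mps_euler_mult) (simp add: mps_mult_def)
next
  case (Suc n)
  have "mps_euler i (mps_power F (Suc (Suc n))) \<beta> =
      mps_mult (mps_euler i F) (mps_power F (Suc n)) \<beta>
      + mps_mult F (\<lambda>\<beta>. of_nat (Suc n) * mps_mult (mps_euler i F) (mps_power F n) \<beta>) \<beta>"
    unfolding mps_power.simps(2)[of F "Suc n"] mps_euler_mult Suc.IH[abs_def] ..
  also have "mps_mult F (\<lambda>\<beta>. of_nat (Suc n) * mps_mult (mps_euler i F) (mps_power F n) \<beta>) \<beta> =
      of_nat (Suc n) * mps_mult F (mps_mult (mps_euler i F) (mps_power F n)) \<beta>"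
    by (simp add: mps_mult_def[of F] sum_distrib_left mult.left_commute del: of_nat_Suc)
  also have "mps_mult F (mps_mult (mps_euler i F) (mps_power F n)) =
      mps_mult (mps_euler i F) (mps_power F (Suc n))"
    by (simp add: mps_mult_left_commute)
  finally show ?case
    by (simp add: algebra_simps)
qed

text \<open>A nonzero factor \<open>F \<gamma>\<close> has \<open>\<gamma> \<noteq> 0\<close>, so
  each multiplication by \<open>F\<close> uses up at least one degree.\<close>

lemma mps_power_eq_0:
  assumes "F 0 = 0" "(\<Sum>i\<in>UNIV. \<beta> i) < n"
  shows "mps_power F n \<beta> = 0"
  using assms(2)
proof (induction n arbitrary: \<beta>)
  case (Suc n)
  have "F \<gamma> * mps_power F n (\<beta> - \<gamma>) = 0" if "\<gamma> \<le> \<beta>" for \<gamma>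
  proof (cases "\<gamma> = 0")
    case False
    have "mps_power F n (\<beta> - \<gamma>) = 0"
      using sum_size_diff_less[OF that False] Suc.prems by (intro Suc.IH) simp
    then show ?thesis by simp
  qed (simp add: assms)
  then show ?case
    by (auto simp: mps_mult_def intro!: sum.neutral)
qed simp

text \<open>One cut-off \<open>N\<close> then serves all coefficients of degree at most
  \<open>N\<close>, so that the finite sum can be moved through a product.\<close>

lemma mps_exp_eq:
  assumes "F 0 = 0" "(\<Sum>i\<in>UNIV. \<beta> i) \<le> N"
  shows "mps_exp F \<beta> = (\<Sum>n\<le>N. mps_power F n \<beta> / fact n)"
  unfolding mps_exp_def using assms
  by (intro sum.mono_neutral_left) (auto simp: mps_power_eq_0)

lemma mps_euler_exp:
  fixes F :: "('i::finite, 'a::field_char_0) mps"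
  assumes "F 0 = 0"
  shows "mps_euler i (mps_exp F) = mps_mult (mps_euler i F) (mps_exp F)"
proof
  fix \<beta> :: "'i \<Rightarrow> nat"
  define N where "N = (\<Sum>i\<in>UNIV. \<beta> i)"
  \<comment> \<open>The cut-off lies one above the degree because the term \<open>n = 0\<close>, on
    which the Euler operator vanishes, is dropped next and the index shifted.\<close>
  have "mps_euler i (mps_exp F) \<beta> = (\<Sum>n\<le>Suc N. mps_euler i (mps_power F n) \<beta> / fact n)"
    by (subst mps_euler_def, subst mps_exp_eq[where N = "Suc N"])
      (simp_all add: assms N_def mps_euler_def sum_distrib_left distrib_left)
  also have "\<dots> = (\<Sum>n\<le>N. mps_euler i (mps_power F (Suc n)) \<beta> / fact (Suc n))"
    by (subst sum.atMost_Suc_shift) (auto simp: mps_euler_def mps_monom_def)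
  also have "\<dots> = (\<Sum>n\<le>N. mps_mult (mps_euler i F) (mps_power F n) \<beta> / fact n)"
    by (simp add: mps_euler_power fact_Suc del: mps_power.simps of_nat_Suc)
  also have "\<dots> = mps_mult (mps_euler i F) (\<lambda>\<gamma>. \<Sum>n\<le>N. mps_power F n \<gamma> / fact n) \<beta>"
    by (subst mps_mult_sum_right) (simp add: mps_mult_def sum_divide_distrib)
  also have "\<dots> = mps_mult (mps_euler i F) (mps_exp F) \<beta>"
    unfolding mps_mult_def
  proof (rule sum.cong)
    fix \<gamma> assume "\<gamma> \<in> {\<gamma>. \<gamma> \<le> \<beta>}"
    have "(\<Sum>i\<in>UNIV. (\<beta> - \<gamma>) i) \<le> N"
      unfolding N_def by (rule sum_mono) simp
    then show "mps_euler i F \<gamma> * (\<Sum>n\<le>N. mps_power F n (\<beta> - \<gamma>) / fact n) =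
        mps_euler i F \<gamma> * mps_exp F (\<beta> - \<gamma>)"
      by (simp add: mps_exp_eq assms)
  qed simp
  finally show "mps_euler i (mps_exp F) \<beta> = mps_mult (mps_euler i F) (mps_exp F) \<beta>" .
qed

section \<open>Series in a single monomial: support on the multiples of one exponent\<close>

definition on_ray :: "('i \<Rightarrow> nat) \<Rightarrow> ('i, 'a::zero) mps \<Rightarrow> bool" where
  "on_ray a F \<longleftrightarrow> (\<forall>\<beta>. F \<beta> \<noteq> 0 \<longrightarrow> (\<exists>n. \<beta> = (\<lambda>i. n * a i)))"

lemma on_ray_mult:
  assumes "on_ray a F" "on_ray a G"
  shows "on_ray a (mps_mult F G)"
  unfolding on_ray_def
proof (intro allI impI)
  fix \<beta> assume "mps_mult F G \<beta> \<noteq> 0"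
  then obtain \<gamma> where \<gamma>: "\<gamma> \<le> \<beta>" "F \<gamma> \<noteq> 0" "G (\<beta> - \<gamma>) \<noteq> 0"
    unfolding mps_mult_def by (metis (no_types, lifting) mem_Collect_eq mult_zero_left mult_zero_right sum.neutral)
  then obtain m n where mn: "\<gamma> = (\<lambda>i. m * a i)" "\<beta> - \<gamma> = (\<lambda>i. n * a i)"
    using assms unfolding on_ray_def by metis
  have "\<beta> i = (m + n) * a i" for i
    using fun_cong[OF mn(1), of i] fun_cong[OF mn(2), of i] \<gamma>(1)
    by (auto simp: le_fun_def algebra_simps) (metis le_add_diff_inverse)
  then show "\<exists>n. \<beta> = (\<lambda>i. n * a i)" by auto
qed

lemma on_ray_exp:
  assumes "on_ray a F"
  shows "on_ray a (mps_exp F)"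
proof -
  have *: "on_ray a (mps_power F n)" for n
  proof (induction n)
    case 0
    then show ?case
      by (auto simp: on_ray_def mps_monom_def fun_eq_iff intro!: exI[of _ "0::nat"])
  qed (simp add: on_ray_mult assms)
  show ?thesis
    unfolding on_ray_def
  proof (intro allI impI)
    fix \<beta> assume "mps_exp F \<beta> \<noteq> 0"
    then obtain n where "mps_power F n \<beta> \<noteq> 0"
      unfolding mps_exp_def by (metis (no_types, lifting) div_0 sum.neutral)
    then show "\<exists>n. \<beta> = (\<lambda>i. n * a i)"
      using *[of n] by (auto simp: on_ray_def)
  qed
qed

lemma on_ray_exp_div_eps: "on_ray a F \<Longrightarrow> on_ray a (mps_exp (div_eps F))"
  unfolding on_ray_def div_eps_def
  by (intro on_ray_exp[unfolded on_ray_def]) (metis div_0 fls_const_0)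

text \<open>A factor on the ray moves exponents only by multiples of \<open>a\<close>, which
  \<open>c\<close> does not see. So multiplication by it commutes with scaling the monomials by
  \<open>c\<close>; this serves both for the critical denominators and for the exponentials
  \<open>wexp\<close>.\<close>

lemma on_ray_mult_invariant:
  assumes "on_ray a F" "\<And>\<beta> n. c (\<lambda>i. \<beta> i + n * a i) = c \<beta>"
  shows "mps_mult F (\<lambda>\<beta>. c \<beta> * G \<beta>) \<beta> = c \<beta> * mps_mult F G \<beta>"
  unfolding mps_mult_def sum_distrib_left
proof (rule sum.cong)
  fix \<gamma> assume "\<gamma> \<in> {\<gamma>. \<gamma> \<le> \<beta>}"
  then have le: "\<gamma> \<le> \<beta>" by simp
  show "F \<gamma> * (c (\<beta> - \<gamma>) * G (\<beta> - \<gamma>)) = c \<beta> * (F \<gamma> * G (\<beta> - \<gamma>))"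
  proof (cases "F \<gamma> = 0")
    case False
    then obtain n where "\<gamma> = (\<lambda>i. n * a i)"
      using assms(1) by (auto simp: on_ray_def)
    then have "(\<lambda>i. (\<beta> - \<gamma>) i + n * a i) = \<beta>"
      using le by (auto simp: le_fun_def)
    then show ?thesis
      using assms(2)[of "\<beta> - \<gamma>" n] by (simp add: ac_simps)
  qed simp
qed simp

section \<open>Solving the recursion over the power series in the deformation parameter\<close>

text \<open>Multiplication by \<open>\<Sum>\<^sub>i \<nu>\<^sub>i\<close>, which is what is left of
  the Toda potential once the exponentials in \<open>\<phi>\<close> are factored out.\<close>

definition mps_shift_sum :: "('i::finite, 'a::comm_semiring_1) mps \<Rightarrow> ('i, 'a) mps" where
  "mps_shift_sum G = (\<lambda>\<beta>. \<Sum>i\<in>UNIV. mps_mult (mps_monom (unit_exp i) 1) G \<beta>)"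

lemma mps_shift_sum_eq: "mps_shift_sum G \<beta> = (\<Sum>i | 0 < \<beta> i. G (\<beta> - unit_exp i))"
  unfolding mps_shift_sum_def mps_mult_monom_left unit_exp_le_iff
  by (simp add: sum.If_cases)

lemma mps_mult_shift_sum: "mps_mult F (mps_shift_sum G) = mps_shift_sum (mps_mult F G)"
proof
  fix \<beta>
  show "mps_mult F (mps_shift_sum G) \<beta> = mps_shift_sum (mps_mult F G) \<beta>"
    unfolding mps_shift_sum_def mps_mult_sum_right
    by (subst mps_mult_left_commute) (rule refl)
qed

text \<open>
  On the ray through \<open>a\<close> the factor \<open>c \<beta> + \<epsilon> \<beta>\<^sub>z\<close> is divisible by \<open>\<epsilon>\<close>; there the coefficient of \<open>F\<close> is
  chosen so that the remaining terms of the equation have no constant term either.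
\<close>

lemma ex_regular_solution:
  fixes c :: "('i::finite, complex) mps" and z :: 'i and a :: "'i \<Rightarrow> nat"
  assumes a: "a z = 1" and c: "\<And>\<beta>. c \<beta> = 0 \<longleftrightarrow> (\<exists>n. \<beta> = (\<lambda>i. n * a i))"
  obtains W :: "('i, complex fps) mps" and F :: "('i, complex) mps"
  where "W 0 = 1" "F 0 = 0" "on_ray a F"
    "\<And>\<beta>. (fps_const (c \<beta>) + of_nat (\<beta> z) * fps_X) * W \<beta>
       + mps_mult (\<lambda>\<gamma>. fps_const (of_nat (\<gamma> z) * F \<gamma>)) W \<beta> = mps_shift_sum W \<beta>"
proof -
  define den :: "('i \<Rightarrow> nat) \<Rightarrow> complex fps" where
    "den = (\<lambda>\<beta>. fps_const (c \<beta>) + of_nat (\<beta> z) * fps_X)"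
  \<comment> \<open>A value \<open>g \<gamma>\<close> is the pair
    \<open>(W \<gamma>, F \<gamma>)\<close>. The ends of the convolution are left out:
    \<open>\<gamma> = 0\<close> contributes zero, and \<open>\<gamma> = \<beta>\<close> contains the
    unknown \<open>F \<beta>\<close>, multiplied by \<open>W 0 = 1\<close>.\<close>
  define rest :: "(('i \<Rightarrow> nat) \<Rightarrow> complex fps \<times> complex) \<Rightarrow> ('i \<Rightarrow> nat) \<Rightarrow> complex fps" where
    "rest = (\<lambda>g \<beta>. \<Sum>\<gamma> | \<gamma> \<le> \<beta> \<and> \<gamma> \<noteq> 0 \<and> \<gamma> \<noteq> \<beta>.
       fps_const (of_nat (\<gamma> z) * snd (g \<gamma>)) * fst (g (\<beta> - \<gamma>)))"
  define shifted :: "(('i \<Rightarrow> nat) \<Rightarrow> complex fps \<times> complex) \<Rightarrow> ('i \<Rightarrow> nat) \<Rightarrow> complex fps" where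
    "shifted = (\<lambda>g \<beta>. \<Sum>i | 0 < \<beta> i. fst (g (\<beta> - unit_exp i)))"
  define P where "P = (\<lambda>g \<beta> r. (\<beta> = 0 \<longrightarrow> r = (1, 0)) \<and>
     (snd r \<noteq> 0 \<longrightarrow> (\<exists>n. \<beta> = (\<lambda>i. n * a i))) \<and>
     (\<beta> \<noteq> 0 \<longrightarrow> den \<beta> * fst r + fps_const (of_nat (\<beta> z) * snd r) + rest g \<beta> = shifted g \<beta>))"
  have c0: "c 0 = 0"
    using c[of 0] by (auto simp: fun_eq_iff intro!: exI[of _ "0::nat"])
  \<comment> \<open>\<open>W\<close> and \<open>F\<close> are chosen together by recursion on the
    total degree, as the condition at \<open>\<beta>\<close> refers to \<open>g\<close> only in
    lower degrees.\<close>
  have "\<exists>g. \<forall>\<beta>. P g \<beta> (g \<beta>)"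
  proof (rule dependent_wf_choice)
    show "wf (Wellfounded.measure (\<lambda>\<beta>::'i \<Rightarrow> nat. \<Sum>i\<in>UNIV. \<beta> i))"
      by (rule wf_measure)
  next
    fix f g :: "('i \<Rightarrow> nat) \<Rightarrow> complex fps \<times> complex" and \<beta> r
    assume "\<And>\<gamma>. (\<gamma>, \<beta>) \<in> Wellfounded.measure (\<lambda>\<beta>. \<Sum>i\<in>UNIV. \<beta> i) \<Longrightarrow> f \<gamma> = g \<gamma>"
    then have eq: "f (\<beta> - \<gamma>) = g (\<beta> - \<gamma>)" if "\<gamma> \<le> \<beta>" "\<gamma> \<noteq> 0" for \<gamma>
      using sum_size_diff_less[OF that] by simp
    have eq': "f \<gamma> = g \<gamma>" if "\<gamma> \<le> \<beta>" "\<gamma> \<noteq> \<beta>" for \<gamma>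
    proof -
      have "\<beta> - \<gamma> \<noteq> 0"
        using that fun_diff_diff_cancel[OF that(1)] by (auto simp del: minus_apply)
      then show ?thesis
        using eq[of "\<beta> - \<gamma>"] that(1) by (simp add: fun_diff_diff_cancel fun_diff_le)
    qed
    have "rest f \<beta> = rest g \<beta>"
      unfolding rest_def by (rule sum.cong) (auto simp: eq eq')
    moreover have "shifted f \<beta> = shifted g \<beta>"
      unfolding shifted_def by (rule sum.cong) (auto simp: eq unit_exp_le_iff unit_exp_neq_0)
    ultimately show "P f \<beta> r = P g \<beta> r"
      by (simp add: P_def)
  next
    fix \<beta> g
    define N where "N = shifted g \<beta> - rest g \<beta>"
    consider "\<beta> = 0" | "c \<beta> \<noteq> 0" | "\<beta> \<noteq> 0" "c \<beta> = 0" by blast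
    then show "\<exists>r. P g \<beta> r"
    proof cases
      case 1
      then show ?thesis by (auto simp: P_def)
    next
      case 2
      then have "\<beta> \<noteq> 0"
        using c0 by metis
      \<comment> \<open>Off the ray the denominator is a unit, and \<open>F\<close> gets the
        coefficient 0.\<close>
      have "den \<beta> $ 0 \<noteq> 0"
        using 2 by (simp add: den_def)
      then obtain w where "den \<beta> * w = N"
        by (metis inverse_mult_eq_1' mult.assoc mult_1)
      then show ?thesis
        using \<open>\<beta> \<noteq> 0\<close> by (intro exI[of _ "(w, 0)"]) (simp add: P_def N_def)
    next
      case 3
      then obtain n where n: "\<beta> = (\<lambda>i. n * a i)"
        using c by blast
      with 3(1) have "n \<noteq> 0" "\<beta> z = n"
        by (auto simp: fun_eq_iff a intro: Nat.gr0I)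
      \<comment> \<open>On the ray \<open>den \<beta>\<close> is \<open>n * fps_X\<close>, which can
        absorb only the part of \<open>N\<close> divisible by \<open>fps_X\<close>; the constant
        term is left to \<open>n * F \<beta>\<close>.\<close>
      have "N = fps_X * fps_shift 1 N + fps_const (N $ 0)"
        by (rule fps_ext) auto
      then have "den \<beta> * (fps_const (1 / of_nat n) * fps_shift 1 N)
          + fps_const (of_nat (\<beta> z) * (N $ 0 / of_nat n)) = N"
        using \<open>n \<noteq> 0\<close> \<open>\<beta> z = n\<close> 3(2)
        by (simp add: den_def fps_of_nat[symmetric] mult.commute mult.left_commute flip: mult.assoc)
      then show ?thesis
        using 3(1) n
        by (intro exI[of _ "(fps_const (1 / of_nat n) * fps_shift 1 N, N $ 0 / of_nat n)"])
          (auto simp: P_def N_def algebra_simps)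
    qed
  qed
  then obtain g where g: "\<And>\<beta>. P g \<beta> (g \<beta>)" by blast
  define W F where "W = (\<lambda>\<beta>. fst (g \<beta>))" and "F = (\<lambda>\<beta>. snd (g \<beta>))"
  show ?thesis
  proof (rule that)
    show "W 0 = 1" "F 0 = 0"
      using g[of 0] by (auto simp: P_def W_def F_def)
    show "on_ray a F"
      using g by (auto simp: P_def F_def on_ray_def)
    fix \<beta> :: "'i \<Rightarrow> nat"
    show "(fps_const (c \<beta>) + of_nat (\<beta> z) * fps_X) * W \<beta>
       + mps_mult (\<lambda>\<gamma>. fps_const (of_nat (\<gamma> z) * F \<gamma>)) W \<beta> = mps_shift_sum W \<beta>"
    proof (cases "\<beta> = 0")
      case True
      with c0 show ?thesis
        by (simp add: mps_mult_zero_exp mps_shift_sum_eq)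
    next
      case False
      have "{\<gamma>. \<gamma> \<le> \<beta>} = insert 0 (insert \<beta> {\<gamma>. \<gamma> \<le> \<beta> \<and> \<gamma> \<noteq> 0 \<and> \<gamma> \<noteq> \<beta>})"
        by (auto simp: le_fun_def)
      moreover have "finite {\<gamma>. \<gamma> \<le> \<beta> \<and> \<gamma> \<noteq> 0 \<and> \<gamma> \<noteq> \<beta>}"
        by (rule finite_subset[OF _ finite_atMost_fun[of \<beta>]]) auto
      ultimately have "mps_mult (\<lambda>\<gamma>. fps_const (of_nat (\<gamma> z) * F \<gamma>)) W \<beta> =
          fps_const (of_nat (\<beta> z) * F \<beta>) + rest g \<beta>"
        using False \<open>W 0 = 1\<close> by (simp add: mps_mult_def rest_def F_def W_def del: minus_apply)
      moreover have "mps_shift_sum W \<beta> = shifted g \<beta>"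
        by (simp add: mps_shift_sum_eq shifted_def W_def)
      ultimately show ?thesis
        using g[of \<beta>] False by (simp add: P_def den_def W_def F_def add.assoc)
    qed
  qed
qed

section \<open>From power series to Laurent series in the deformation parameter\<close>

lemma fps_to_fls_sum: "fps_to_fls (\<Sum>i\<in>I. f i) = (\<Sum>i\<in>I. fps_to_fls (f i))"
  by (induction I rule: infinite_finite_induct) (simp_all add: fps_to_fls_plus)

lemma mps_mult_fps_to_fls:
  "mps_mult (\<lambda>\<gamma>. fps_to_fls (F \<gamma>)) (\<lambda>\<gamma>. fps_to_fls (G \<gamma>)) \<beta> = fps_to_fls (mps_mult F G \<beta>)"
  by (simp add: mps_mult_def fps_to_fls_sum fls_times_fps_to_fls)

lemma mps_shift_sum_fps_to_fls:
  "mps_shift_sum (\<lambda>\<gamma>. fps_to_fls (G \<gamma>)) \<beta> = fps_to_fls (mps_shift_sum G \<beta>)"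
  by (simp add: mps_shift_sum_eq fps_to_fls_sum)

text \<open>
  The exponential turns the regular equation with the extra term \<open>\<nu>\<^sub>z \<partial>F/\<partial>\<nu>\<^sub>z\<close> into the original
  one, because \<open>\<epsilon> \<nu>\<^sub>z \<partial>/\<partial>\<nu>\<^sub>z\<close> is a derivation and \<open>c\<close> is invariant along the ray.
\<close>

lemma exp_mult_regular_solution:
  fixes c :: "('i::finite, complex) mps" and W :: "('i, complex fps) mps"
  assumes F: "F 0 = 0" "on_ray a F" and c: "\<And>\<beta> n. c (\<lambda>i. \<beta> i + n * a i) = c \<beta>"
    and W: "\<And>\<beta>. (fps_const (c \<beta>) + of_nat (\<beta> z) * fps_X) * W \<beta>
       + mps_mult (\<lambda>\<gamma>. fps_const (of_nat (\<gamma> z) * F \<gamma>)) W \<beta> = mps_shift_sum W \<beta>"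
  defines "V \<equiv> mps_mult (mps_exp (div_eps F)) (\<lambda>\<beta>. fps_to_fls (W \<beta>))"
  shows "(fls_const (c \<beta>) + of_nat (\<beta> z) * fls_X) * V \<beta> = mps_shift_sum V \<beta>"
proof -
  define E where "E = mps_exp (div_eps F)"
  define L where "L = (\<lambda>\<beta>. fps_to_fls (W \<beta>))"
  define dF where "dF = (\<lambda>\<gamma>. fls_const (of_nat (\<gamma> z) * F \<gamma>))"
  have E: "on_ray a E"
    unfolding E_def by (rule on_ray_exp_div_eps[OF F(2)])
  have V: "V = mps_mult E L"
    by (simp add: V_def E_def L_def)
  have "mps_euler z E = mps_mult (mps_euler z (div_eps F)) E"
    unfolding E_def by (rule mps_euler_exp) (simp add: div_eps_def F)
  moreover have "fls_X * mps_euler z (div_eps F) \<gamma> = dF \<gamma>" for \<gamma>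
  proof -
    have "fls_X * mps_euler z (div_eps F) \<gamma> = of_nat (\<gamma> z) * (fls_X * (fls_const (F \<gamma>) / fls_X))"
      unfolding mps_euler_def div_eps_def by (rule mult.left_commute)
    also have "fls_X * (fls_const (F \<gamma>) / fls_X) = fls_const (F \<gamma>)"
      unfolding times_divide_eq_right by (rule nonzero_mult_div_cancel_left) simp
    finally show ?thesis
      by (simp add: dF_def fls_of_nat)
  qed
  \<comment> \<open>The factor \<open>fls_X\<close> cancels the denominator in
    \<open>div_eps\<close>, so differentiating the exponential produces exactly the factor
    \<open>dF\<close>.\<close>
  ultimately have dE: "fls_X * mps_euler z E \<gamma> = mps_mult dF E \<gamma>" for \<gamma>
    by (simp add: mps_mult_def sum_distrib_left flip: mult.assoc)
  have L: "fls_const (c \<gamma>) * L \<gamma> + fls_X * mps_euler z L \<gamma> + mps_mult dF L \<gamma> = mps_shift_sum L \<gamma>" for \<gamma>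
  proof -
    have "dF = (\<lambda>\<gamma>. fps_to_fls (fps_const (of_nat (\<gamma> z) * F \<gamma>)))"
      by (simp add: dF_def)
    then have "mps_mult dF L \<gamma> = fps_to_fls (mps_mult (\<lambda>\<gamma>. fps_const (of_nat (\<gamma> z) * F \<gamma>)) W \<gamma>)"
      unfolding L_def by (simp only: mps_mult_fps_to_fls)
    moreover have "fls_const (c \<gamma>) * L \<gamma> + fls_X * mps_euler z L \<gamma> =
        fps_to_fls ((fps_const (c \<gamma>) + of_nat (\<gamma> z) * fps_X) * W \<gamma>)"
      by (simp add: L_def mps_euler_def fls_times_fps_to_fls fps_to_fls_plus algebra_simps)
    ultimately show ?thesis
      using arg_cong[OF W[of \<gamma>], of fps_to_fls]
      by (simp add: L_def mps_shift_sum_fps_to_fls fps_to_fls_plus)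
  qed
  have "(fls_const (c \<beta>) + of_nat (\<beta> z) * fls_X) * V \<beta>
      = fls_const (c \<beta>) * V \<beta> + fls_X * mps_euler z V \<beta>"
    by (simp add: mps_euler_def algebra_simps)
  \<comment> \<open>Here the invariance of \<open>c\<close> along the ray lets it pass the factor
    \<open>E\<close>.\<close>
  also have "fls_const (c \<beta>) * V \<beta> = mps_mult E (\<lambda>\<gamma>. fls_const (c \<gamma>) * L \<gamma>) \<beta>"
    unfolding V using on_ray_mult_invariant[OF E, of "\<lambda>\<gamma>. fls_const (c \<gamma>)" L \<beta>] by (simp add: c)
  also have "fls_X * mps_euler z V \<beta> =
      mps_mult (mps_mult dF E) L \<beta> + mps_mult E (\<lambda>\<gamma>. fls_X * mps_euler z L \<gamma>) \<beta>"
    unfolding V mps_euler_mult distrib_left dE[symmetric]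
    by (simp add: mps_mult_def sum_distrib_left ac_simps)
  also have "mps_mult (mps_mult dF E) L = mps_mult E (mps_mult dF L)"
    by (metis mps_mult_assoc mps_mult_comm)
  \<comment> \<open>Collected, the terms are \<open>E\<close> times the left-hand side of the
    regular equation.\<close>
  also have "mps_mult E (\<lambda>\<gamma>. fls_const (c \<gamma>) * L \<gamma>) \<beta> + (mps_mult E (mps_mult dF L) \<beta>
      + mps_mult E (\<lambda>\<gamma>. fls_X * mps_euler z L \<gamma>) \<beta>) = mps_mult E (mps_shift_sum L) \<beta>"
    unfolding L[symmetric, abs_def] by (simp add: mps_mult_add_right)
  also have "\<dots> = mps_shift_sum V \<beta>"
    by (simp add: V mps_mult_shift_sum)
  finally show ?thesis .
qed

section \<open>Paths and the Whittaker coefficients\<close>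

text \<open>A step raises a coordinate, so no step can end at \<open>0\<close>.\<close>

lemma root_paths_0: "root_paths 0 = {[0]}"
proof -
  have "p = [0]" if p: "p \<in> root_paths (0 :: 'i \<Rightarrow> nat)" for p
  proof (cases p rule: rev_cases)
    case Nil
    with p show ?thesis by (simp add: root_paths_def)
  next
    case (snoc q x)
    show ?thesis
    proof (cases q rule: rev_cases)
      case (snoc q' y)
      have "Suc (length q') < length p"
        using \<open>p = q @ [x]\<close> snoc by simp
      then obtain i where "p ! Suc (length q') = p ! length q' + unit_exp i"
        using p unfolding root_paths_def by blast
      then have "x i = y i + 1"
        using \<open>p = q @ [x]\<close> snoc by (simp add: nth_append unit_exp_def)
      moreover have "x = 0"
        using p \<open>p = q @ [x]\<close> by (simp add: root_paths_def)
      ultimately show ?thesis by simp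
    qed (use p snoc in \<open>auto simp: root_paths_def\<close>)
  qed
  then show ?thesis
    by (auto simp: root_paths_def)
qed

text \<open>The condition \<open>0 < \<beta> i\<close> makes the truncated subtraction a true one,
  so that appending \<open>\<beta>\<close> is a step by \<open>unit_exp i\<close>.\<close>

lemma root_paths_step:
  assumes "\<beta> \<noteq> 0"
  shows "root_paths \<beta> = (\<Union>i\<in>{i. 0 < \<beta> i}. (\<lambda>p. p @ [\<beta>]) ` root_paths (\<beta> - unit_exp i))"
proof (intro equalityI subsetI)
  fix p assume p: "p \<in> root_paths \<beta>"
  obtain q where q: "p = q @ [\<beta>]"
    using p by (cases p rule: rev_cases) (auto simp: root_paths_def)
  have "q \<noteq> []"
    using p q assms by (auto simp: root_paths_def)
  then obtain q' x where q': "q = q' @ [x]"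
    by (cases q rule: rev_cases) auto
  have "Suc (length q') < length p"
    using q q' by simp
  then obtain i where "p ! Suc (length q') = p ! length q' + unit_exp i"
    using p unfolding root_paths_def by blast
  then have \<beta>: "\<beta> = x + unit_exp i"
    using q q' by (simp add: nth_append)
  have "q ! Suc k = q ! k + unit_exp j \<longleftrightarrow> p ! Suc k = p ! k + unit_exp j"
    if "Suc k < length q" for k j
    using that q by (simp add: nth_append)
  then have "q \<in> root_paths x"
    using p q q' by (auto simp: root_paths_def hd_append)
  moreover have "x = \<beta> - unit_exp i" "0 < \<beta> i"
    by (auto simp: \<beta> fun_eq_iff unit_exp_def)
  ultimately show "p \<in> (\<Union>i\<in>{i. 0 < \<beta> i}. (\<lambda>p. p @ [\<beta>]) ` root_paths (\<beta> - unit_exp i))"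
    using q by blast
next
  fix p assume "p \<in> (\<Union>i\<in>{i. 0 < \<beta> i}. (\<lambda>p. p @ [\<beta>]) ` root_paths (\<beta> - unit_exp i))"
  then obtain i q where i: "0 < \<beta> i" and q: "q \<in> root_paths (\<beta> - unit_exp i)" and p: "p = q @ [\<beta>]"
    by auto
  have "q \<noteq> []" "hd q = 0" "last q = \<beta> - unit_exp i"
    using q by (auto simp: root_paths_def)
  have "\<exists>j. p ! Suc k = p ! k + unit_exp j" if "Suc k < length p" for k
  proof (cases "Suc k < length q")
    case True
    then obtain j where "q ! Suc k = q ! k + unit_exp j"
      using q unfolding root_paths_def by blast
    then show ?thesis
      using True p by (auto simp: nth_append)
  next
    case False
    then have k: "k = length q - 1" "k < length q"
      using that p \<open>q \<noteq> []\<close> by auto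
    then have "p ! k = \<beta> - unit_exp i" "p ! Suc k = \<beta>"
      using p \<open>last q = _\<close> \<open>q \<noteq> []\<close> by (simp_all add: nth_append last_conv_nth)
    moreover have "\<beta> = \<beta> - unit_exp i + unit_exp i"
      using i by (auto simp: fun_eq_iff unit_exp_def)
    ultimately show ?thesis by metis
  qed
  then show "p \<in> root_paths \<beta>"
    using p \<open>q \<noteq> []\<close> \<open>hd q = 0\<close> by (auto simp: root_paths_def)
qed

lemma finite_root_paths: "finite (root_paths (\<beta> :: 'i::finite \<Rightarrow> nat))"
proof (induction "\<Sum>i\<in>UNIV. \<beta> i" arbitrary: \<beta> rule: less_induct)
  case less
  show ?case
  proof (cases "\<beta> = 0")
    case False
    have "finite (root_paths (\<beta> - unit_exp i))" if "0 < \<beta> i" for i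
      using that sum_size_diff_less[of "unit_exp i" \<beta>]
      by (intro less) (auto simp: unit_exp_le_iff unit_exp_neq_0)
    then show ?thesis
      by (simp add: root_paths_step[OF False])
  qed (simp add: root_paths_0)
qed

text \<open>All paths to \<open>\<beta>\<close> share the factor of their last vertex, and the start
  \<open>0\<close> carries none, because the product begins at index 1. With
  \<open>1 / 0 = 0\<close> the identity also covers zeros of \<open>v\<close>.\<close>

lemma sum_root_paths:
  fixes v :: "('i::finite \<Rightarrow> nat) \<Rightarrow> 'a::field"
  defines "Z \<equiv> (\<lambda>\<beta>. \<Sum>p\<in>root_paths \<beta>. \<Prod>k\<in>{1..<length p}. 1 / v (p ! k))"
  assumes "\<beta> \<noteq> 0"
  shows "Z \<beta> = 1 / v \<beta> * mps_shift_sum Z \<beta>"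
proof -
  let ?w = "\<lambda>p. \<Prod>k\<in>{1..<length p}. 1 / v (p ! k)"
  have last: "last p = \<beta> - unit_exp i" if "p \<in> root_paths (\<beta> - unit_exp i)" for p i
    using that by (simp add: root_paths_def)
  have inj: "i = j" if "\<beta> - unit_exp i = \<beta> - unit_exp j" "0 < \<beta> i" "0 < \<beta> j" for i j
    using fun_cong[OF that(1), of i] that(2) by (auto simp: unit_exp_def split: if_splits)
  have w: "?w (p @ [\<beta>]) = 1 / v \<beta> * ?w p" if "p \<in> root_paths (\<beta> - unit_exp i)" for p i
  proof -
    have "p \<noteq> []"
      using that by (simp add: root_paths_def)
    then have "{1..<length (p @ [\<beta>])} = insert (length p) {1..<length p}"
      by (auto simp: Suc_le_eq)
    then have "?w (p @ [\<beta>]) = 1 / v \<beta> * (\<Prod>k\<in>{1..<length p}. 1 / v ((p @ [\<beta>]) ! k))"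
      by simp
    also have "(\<Prod>k\<in>{1..<length p}. 1 / v ((p @ [\<beta>]) ! k)) = ?w p"
      by (rule prod.cong) (auto simp: nth_append)
    finally show ?thesis .
  qed
  \<comment> \<open>The families for different \<open>i\<close> are disjoint, as their paths differ
    in the vertex before the last.\<close>
  have "Z \<beta> = (\<Sum>i | 0 < \<beta> i. \<Sum>p\<in>(\<lambda>p. p @ [\<beta>]) ` root_paths (\<beta> - unit_exp i). ?w p)"
    unfolding Z_def root_paths_step[OF assms(2)]
    by (rule sum.UNION_disjoint) (auto simp: finite_root_paths dest!: last dest: inj)
  also have "\<dots> = (\<Sum>i | 0 < \<beta> i. \<Sum>p\<in>root_paths (\<beta> - unit_exp i). ?w (p @ [\<beta>]))"
    by (simp add: sum.reindex inj_on_def)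
  also have "\<dots> = (\<Sum>i | 0 < \<beta> i. 1 / v \<beta> * Z (\<beta> - unit_exp i))"
    unfolding Z_def sum_distrib_left by (intro sum.cong refl w)
  also have "\<dots> = 1 / v \<beta> * mps_shift_sum Z \<beta>"
    by (simp add: mps_shift_sum_eq sum_distrib_left)
  finally show ?thesis .
qed

text \<open>Induction on the total degree: the path sums and \<open>V\<close> obey the same
  recursion, and a nonzero \<open>d \<beta>\<close> can be divided by in the field of Laurent
  series.\<close>

lemma laurent_expansion_sum_root_paths:
  fixes c :: "('i::finite \<Rightarrow> nat) \<Rightarrow> complex" and V :: "('i, complex fls) mps" and z :: 'i
  defines "d \<equiv> (\<lambda>\<beta>. fls_const (c \<beta>) + of_nat (\<beta> z) * fls_X)"
  assumes "V 0 = 1" "\<And>\<beta>. \<beta> \<noteq> 0 \<Longrightarrow> d \<beta> \<noteq> 0" "\<And>\<beta>. \<beta> \<noteq> 0 \<Longrightarrow> d \<beta> * V \<beta> = mps_shift_sum V \<beta>"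
  shows "(\<lambda>\<epsilon>. \<Sum>p\<in>root_paths \<beta>. \<Prod>k\<in>{1..<length p}. 1 / (c (p ! k) + of_nat ((p ! k) z) * \<epsilon>))
    has_laurent_expansion V \<beta>"
proof (induction "\<Sum>i\<in>UNIV. \<beta> i" arbitrary: \<beta> rule: less_induct)
  case less
  show ?case
  proof (cases "\<beta> = 0")
    case True
    have "(\<lambda>_. 1 :: complex) has_laurent_expansion 1"
      by (rule has_laurent_expansion_1)
    with True show ?thesis
      by (simp add: root_paths_0 assms(2))
  next
    case False
    define Z where "Z = (\<lambda>\<epsilon> \<beta>. \<Sum>p\<in>root_paths \<beta>. \<Prod>k\<in>{1..<length p}. 1 / (c (p ! k) + of_nat ((p ! k) z) * \<epsilon>))"
    have "(\<lambda>\<epsilon>. Z \<epsilon> (\<beta> - unit_exp i)) has_laurent_expansion V (\<beta> - unit_exp i)" if "0 < \<beta> i" for i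
      unfolding Z_def using that sum_size_diff_less[of "unit_exp i" \<beta>]
      by (intro less) (auto simp: unit_exp_le_iff unit_exp_neq_0)
    then have sum: "(\<lambda>\<epsilon>. mps_shift_sum (Z \<epsilon>) \<beta>) has_laurent_expansion mps_shift_sum V \<beta>"
      unfolding mps_shift_sum_eq by (intro laurent_expansion_intros) auto
    have "(\<lambda>\<epsilon>. c \<beta> + of_nat (\<beta> z) * \<epsilon>) has_laurent_expansion d \<beta>"
      unfolding d_def by (auto simp: fls_of_nat intro!: laurent_expansion_intros)
    with sum have "(\<lambda>\<epsilon>. mps_shift_sum (Z \<epsilon>) \<beta> / (c \<beta> + of_nat (\<beta> z) * \<epsilon>))
        has_laurent_expansion mps_shift_sum V \<beta> / d \<beta>"
      by (rule has_laurent_expansion_divide)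
    moreover have "mps_shift_sum V \<beta> / d \<beta> = V \<beta>"
      using assms(3,4)[OF False] by (metis nonzero_mult_div_cancel_left)
    moreover have "Z \<epsilon> \<beta> = mps_shift_sum (Z \<epsilon>) \<beta> / (c \<beta> + of_nat (\<beta> z) * \<epsilon>)" for \<epsilon>
      unfolding Z_def
      using sum_root_paths[OF False, of "\<lambda>\<beta>. c \<beta> + of_nat (\<beta> z) * \<epsilon>"] by simp
    ultimately show ?thesis
      by (simp add: Z_def)
  qed
qed

section \<open>Affine weights\<close>

lemma zero_in_weights: "0 \<in> weights D"
  and add_in_weights: "x \<in> weights D \<Longrightarrow> y \<in> weights D \<Longrightarrow> x + y \<in> weights D"
  and diff_in_weights: "x \<in> weights D \<Longrightarrow> y \<in> weights D \<Longrightarrow> x - y \<in> weights D"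
  and wscale_in_weights: "x \<in> weights D \<Longrightarrow> wscale c x \<in> weights D"
  by (auto simp: weights_def wscale_def algebra_simps)

lemma sum_in_weights: "(\<And>i. i \<in> I \<Longrightarrow> f i \<in> weights D) \<Longrightarrow> (\<Sum>i\<in>I. f i) \<in> weights D"
  by (induction I rule: infinite_finite_induct) (auto intro: zero_in_weights add_in_weights)

lemma wscale_sum: "wscale c (\<Sum>i\<in>I. f i) = (\<Sum>i\<in>I. wscale c (f i))"
  by (induction I rule: infinite_finite_induct) (auto simp: wscale_def fun_eq_iff distrib_left)

lemma wscale_add_left: "wscale (a + b) x = wscale a x + wscale b x"
  by (auto simp: wscale_def distrib_right)

lemma wscale_diff_left: "wscale (a - b) x = wscale a x - wscale b x"
  by (auto simp: wscale_def left_diff_distrib)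

lemma wscale_wscale: "wscale a (wscale b x) = wscale (a * b) x"
  by (auto simp: wscale_def)

lemma aweight_sum: "(\<Sum>i\<in>I. (f i, g i, h i)) = (\<Sum>i\<in>I. f i, \<Sum>i\<in>I. g i, \<Sum>i\<in>I. h i)"
  by (induction I rule: infinite_finite_induct) (auto simp: zero_prod_def)

lemma UNIV_option_sum:
  fixes f :: "'n::finite option \<Rightarrow> 'b::comm_monoid_add"
  shows "(\<Sum>i\<in>UNIV. f i) = f None + (\<Sum>i\<in>UNIV. f (Some i))"
  by (simp add: UNIV_option_conv sum.reindex)

lemma asroot_eq: "asroot D i = (gradient D i, of_bool (i = None), 0)"
  by (simp add: asroot_def gradient_def delta_def fin_wt_def split: option.split)

lemma sum_wscale_gradient:
  "(\<Sum>i\<in>UNIV. wscale (c i) (gradient D i)) =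
     (\<Sum>i\<in>UNIV. wscale (c (Some i)) (sroot D i)) - wscale (c None) (theta D)"
  by (simp add: UNIV_option_sum gradient_def wscale_def fun_eq_iff)

lemma cone_fin_gradient: "cone_fin D \<beta> = (\<Sum>i\<in>UNIV. wscale (of_nat (\<beta> i)) (gradient D i))"
  by (simp add: sum_wscale_gradient cone_fin_def)

lemma cone_wt_eq: "cone_wt D \<beta> = (cone_fin D \<beta>, of_nat (\<beta> None), 0)"
  by (simp add: cone_wt_def asroot_eq awscale_def aweight_sum cone_fin_gradient UNIV_option_sum)

lemma cone_fin_add: "cone_fin D (\<lambda>i. \<beta> i + \<gamma> i) = cone_fin D \<beta> + cone_fin D \<gamma>"
  by (simp add: cone_fin_gradient wscale_add_left sum.distrib)

lemma cone_fin_unit_exp: "cone_fin D (unit_exp i) = gradient D i"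
proof -
  have "wscale (of_nat (unit_exp i j)) (gradient D j) = (if j = i then gradient D i else 0)" for j
    by (simp add: unit_exp_def wscale_def fun_eq_iff)
  then show ?thesis
    by (simp add: cone_fin_gradient)
qed

lemma cone_fin_diff_unit_exp:
  assumes "0 < \<beta> i"
  shows "cone_fin D \<beta> = cone_fin D (\<beta> - unit_exp i) + gradient D i"
proof -
  have "\<beta> = (\<lambda>j. (\<beta> - unit_exp i) j + unit_exp i j)"
    using assms by (auto simp: unit_exp_def)
  then show ?thesis
    by (metis cone_fin_add cone_fin_unit_exp)
qed

text \<open>Integer coefficients in the simple roots, the form to which \<open>generic\<close> and
  linear independence apply.\<close>

lemma cone_fin_sroot:
  "cone_fin D \<beta> = (\<Sum>i\<in>UNIV. wscale (of_int (int (\<beta> (Some i)) - int (\<beta> None * mark D (Some i)))) (sroot D i))"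
  by (simp add: cone_fin_def theta_def wscale_sum wscale_wscale wscale_diff_left sum_subtractf)

context affine_data
begin

section \<open>Weights and the bilinear form\<close>

lemma sroot_in: "sroot D i \<in> weights D"
  using simple_roots by (simp add: simple_roots_def roots_def)

lemma theta_in: "theta D \<in> weights D"
  unfolding theta_def by (intro sum_in_weights wscale_in_weights sroot_in)

lemma gradient_in: "gradient D i \<in> weights D"
  using wscale_in_weights[OF theta_in, of "-1"]
  by (auto simp: gradient_def sroot_in wscale_def fun_Compl_def split: option.split)

lemma cone_fin_in: "cone_fin D \<beta> \<in> weights D"
  unfolding cone_fin_gradient by (intro sum_in_weights wscale_in_weights gradient_in)

lemma rho_in: "rho D \<in> weights D"
  unfolding rho_def by (intro sum_in_weights fweight_in)

lemma phi_fin_in: "phi_fin D \<phi> \<in> weights D"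
  unfolding phi_fin_def by (intro diff_in_weights sum_in_weights wscale_in_weights sroot_in theta_in)

lemma bform_add_right:
  assumes "x \<in> weights D" "y \<in> weights D" "z \<in> weights D"
  shows "bform D x (y + z) = bform D x y + bform D x z"
  using assms by (metis bform_add bform_sym add_in_weights)

lemma bform_scale_right:
  assumes "x \<in> weights D" "y \<in> weights D"
  shows "bform D x (wscale c y) = c * bform D x y"
  using assms by (metis bform_scale bform_sym wscale_in_weights)

lemma bform_diff:
  assumes "x \<in> weights D" "y \<in> weights D" "z \<in> weights D"
  shows "bform D (x - y) z = bform D x z - bform D y z"
  using bform_add[of "x - y" y z] assms by (simp add: diff_in_weights)

lemma bform_diff_right:
  assumes "x \<in> weights D" "y \<in> weights D" "z \<in> weights D"
  shows "bform D x (y - z) = bform D x y - bform D x z"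
  using assms by (metis bform_diff bform_sym diff_in_weights)

lemma bform_zero:
  assumes "x \<in> weights D"
  shows "bform D 0 x = 0" "bform D x 0 = 0"
  using bform_diff[of x x x] bform_diff_right[of x x x] assms by simp_all

lemma bform_sum:
  assumes "\<And>i. i \<in> I \<Longrightarrow> f i \<in> weights D" "x \<in> weights D"
  shows "bform D (\<Sum>i\<in>I. f i) x = (\<Sum>i\<in>I. bform D (f i) x)"
  using assms(1)
  by (induction I rule: infinite_finite_induct)
    (auto simp: bform_add bform_zero assms(2) sum_in_weights simp del: plus_fun_apply)

lemma bform_sum_right:
  assumes "\<And>i. i \<in> I \<Longrightarrow> f i \<in> weights D" "x \<in> weights D"
  shows "bform D x (\<Sum>i\<in>I. f i) = (\<Sum>i\<in>I. bform D x (f i))"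
proof -
  have "bform D x (\<Sum>i\<in>I. f i) = bform D (\<Sum>i\<in>I. f i) x"
    using assms by (intro bform_sym sum_in_weights) auto
  also have "\<dots> = (\<Sum>i\<in>I. bform D x (f i))"
    using assms by (subst bform_sum) (auto intro!: sum.cong bform_sym)
  finally show ?thesis .
qed

lemma ascoroot_fin: "ascoroot D (Some i) = fin_wt (wscale (1 / of_real (symm D (Some i))) (sroot D i))"
  by (simp add: ascoroot_def asroot_def awscale_def fin_wt_def)

lemma fweight_sroot:
  "bform D (fweight D p) (wscale (1 / of_real (symm D (Some q))) (sroot D q)) = of_bool (p = q)"
  using fweight_dual[of p q] unfolding ascoroot_fin by (simp add: fin_wt_def aform_def)

lemma sroot_span:
  assumes "x \<in> weights D"
  obtains c where "x = (\<Sum>i\<in>UNIV. wscale (c i) (sroot D i))"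
  using simple_roots assms unfolding simple_roots_def by blast

lemma sroot_independent:
  assumes "(\<Sum>i\<in>UNIV. wscale (c i) (sroot D i)) = 0"
  shows "c i = 0"
proof -
  have "\<exists>!c. 0 = (\<Sum>i\<in>UNIV. wscale (c i) (sroot D i))"
    using simple_roots zero_in_weights[of D] unfolding simple_roots_def by blast
  then obtain c0 where c0: "\<And>c. 0 = (\<Sum>i\<in>UNIV. wscale (c i) (sroot D i)) \<Longrightarrow> c = c0"
    by (elim ex1E) blast
  have "c = c0"
    by (rule c0) (simp add: assms)
  moreover have "(\<lambda>_. 0) = c0"
    by (rule c0) (simp add: wscale_def fun_eq_iff)
  ultimately have "c = (\<lambda>_. 0)" by simp
  then show ?thesis by simp
qed

text \<open>Independence of the simple roots gives
  \<open>\<beta>\<^sub>i = \<beta>\<^sub>0 a\<^sub>i\<close>; as \<open>a\<^sub>0 = 1\<close>, these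
  are the multiples of \<open>\<delta>\<close>, with \<open>n = \<beta>\<^sub>0\<close>.\<close>

lemma cone_fin_eq_0_iff: "cone_fin D \<beta> = 0 \<longleftrightarrow> (\<exists>n. \<beta> = (\<lambda>i. n * mark D i))"
proof
  assume "cone_fin D \<beta> = 0"
  then have "of_int (int (\<beta> (Some i)) - int (\<beta> None * mark D (Some i))) = (0 :: complex)" for i
    unfolding cone_fin_sroot by (rule sroot_independent)
  then have "int (\<beta> (Some i)) - int (\<beta> None * mark D (Some i)) = 0" for i
    unfolding of_int_eq_0_iff .
  then have "\<beta> (Some i) = \<beta> None * mark D (Some i)" for i
    by (metis eq_iff_diff_eq_0 of_nat_eq_iff)
  then have "\<beta> i = \<beta> None * mark D i" for i
    by (cases i) (simp_all add: mark_0)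
  then show "\<exists>n. \<beta> = (\<lambda>i. n * mark D i)" by blast
next
  assume "\<exists>n. \<beta> = (\<lambda>i. n * mark D i)"
  then show "cone_fin D \<beta> = 0"
    by (auto simp: cone_fin_sroot mark_0 wscale_def fun_eq_iff)
qed

lemma cone_fin_add_ray: "cone_fin D (\<lambda>i. \<beta> i + n * mark D i) = cone_fin D \<beta>"
proof -
  have "cone_fin D (\<lambda>i. n * mark D i) = 0"
    unfolding cone_fin_eq_0_iff by blast
  then show ?thesis
    by (simp add: cone_fin_add)
qed

text \<open>
  The dual bases \<open>\<omega>\<^sub>i\<close> and \<open>\<alpha>\<^sub>i\<^sup>\<or>\<close>: both sides of \<open>x = \<Sum>\<^sub>i (x|\<alpha>\<^sub>i\<^sup>\<or>) \<omega>\<^sub>i\<close> have the same pairing with all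
  \<open>\<alpha>\<^sub>k\<close>, which is all that is needed here.
\<close>

lemma bform_self_fweight:
  assumes x: "x \<in> weights D"
  defines "p \<equiv> \<lambda>i. bform D x (wscale (1 / of_real (symm D (Some i))) (sroot D i))"
  shows "bform D x x = (\<Sum>i\<in>UNIV. \<Sum>j\<in>UNIV. bform D (fweight D i) (fweight D j) * (p i * p j))"
proof -
  define y where "y = (\<Sum>i\<in>UNIV. wscale (p i) (fweight D i))"
  have y: "y \<in> weights D"
    unfolding y_def by (intro sum_in_weights wscale_in_weights fweight_in)
  have "bform D y (sroot D k) = bform D x (sroot D k)" for k
  proof -
    let ?d = "complex_of_real (symm D (Some k))"
    have "?d \<noteq> 0"
      using symm_pos[of "Some k"] by simp
    then have k: "sroot D k = wscale ?d (wscale (1 / ?d) (sroot D k))"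
      by (simp add: wscale_wscale) (simp add: wscale_def)
    have "bform D y (wscale (1 / ?d) (sroot D k)) = p k"
      unfolding y_def
      by (simp add: bform_sum bform_scale fweight_sroot wscale_in_weights fweight_in sroot_in
            of_bool_def if_distrib cong: if_cong)
    then show ?thesis
      by (subst (1 2) k) (use \<open>?d \<noteq> 0\<close> in \<open>simp add: bform_scale_right wscale_in_weights sroot_in x y p_def\<close>)
  qed
  then have "bform D y z = bform D x z" if "z \<in> weights D" for z
    using sroot_span[OF that] by (metis (no_types, lifting) bform_scale_right bform_sum_right
        sroot_in sum.cong wscale_in_weights x y)
  \<comment> \<open>Equal pairings with all weights and symmetry give
    \<open>(x|x) = (y|x) = (x|y) = (y|y)\<close>.\<close>
  then have "bform D x x = bform D y y"
    using x y bform_sym by metis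
  also have "\<dots> = (\<Sum>i\<in>UNIV. \<Sum>j\<in>UNIV. bform D (fweight D i) (fweight D j) * (p i * p j))"
    unfolding y_def
    by (subst sum.swap) (simp add: bform_sum bform_sum_right bform_scale bform_scale_right wscale_in_weights fweight_in
          sum_in_weights sum_distrib_left ac_simps)
  finally show ?thesis .
qed

text \<open>The value of \<open>v_hat\<close> at the critical level,
  \<open>\<epsilon> = 0\<close>.\<close>

definition v_crit :: "'g weight \<Rightarrow> ('n option \<Rightarrow> nat) \<Rightarrow> complex" where
  "v_crit lam \<beta> = bform D (lam + rho D) (cone_fin D \<beta>) - 1/2 * bform D (cone_fin D \<beta>) (cone_fin D \<beta>)"

text \<open>The \<open>h\<^sup>\<or> \<Lambda>\<^sub>0\<close> in \<open>rho_hat\<close> completes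
  the level to \<open>\<epsilon>\<close>, and \<open>\<epsilon> \<Lambda>\<^sub>0\<close> meets only
  the \<open>\<delta>\<close>-component \<open>\<beta>\<^sub>0\<close>.\<close>

lemma v_hat_eq:
  "v_hat D (awscale (\<epsilon> - of_real (dual_coxeter D)) Lambda0 + fin_wt lam) \<beta> = v_crit lam \<beta> + of_nat (\<beta> None) * \<epsilon>"
  by (simp add: v_hat_def v_crit_def rho_hat_def aform_def cone_wt_eq awscale_def Lambda0_def fin_wt_def
      wscale_def zero_fun_def[symmetric] algebra_simps)

lemma v_crit_eq_0_iff:
  assumes "lam \<in> weights D" "generic D lam"
  shows "v_crit lam \<beta> = 0 \<longleftrightarrow> (\<exists>n. \<beta> = (\<lambda>i. n * mark D i))"
proof -
  have "v_crit lam \<beta> = 0 \<longleftrightarrow> cone_fin D \<beta> = 0"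
  proof
    assume "v_crit lam \<beta> = 0"
    then show "cone_fin D \<beta> = 0"
      using assms(2)[unfolded generic_def, rule_format, OF cone_fin_sroot[of D \<beta>]]
      unfolding v_crit_def by blast
  next
    assume "cone_fin D \<beta> = 0"
    then show "v_crit lam \<beta> = 0"
      by (simp add: v_crit_def bform_zero zero_in_weights add_in_weights assms rho_in)
  qed
  then show ?thesis
    by (simp add: cone_fin_eq_0_iff)
qed

lemma E_eigen_minus_v_crit:
  assumes "lam \<in> weights D"
  defines "x \<equiv> \<lambda>\<beta>. lam + rho D - cone_fin D \<beta>"
  shows "1/2 * bform D (x \<beta>) (x \<beta>) = E_eigen D lam - v_crit lam \<beta>"
  unfolding x_def E_eigen_def v_crit_def
  using bform_sym[of "lam + rho D" "cone_fin D \<beta>"]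
  by (simp add: bform_diff bform_diff_right diff_in_weights add_in_weights rho_in assms cone_fin_in
      field_simps)

section \<open>The Toda operator\<close>

text \<open>Neither argument has a \<open>\<Lambda>\<^sub>0\<close>-component, so their
  \<open>\<delta>\<close>-components pair to zero.\<close>

lemma aform_asroot_phi_hat: "aform D (asroot D j) (phi_hat D \<phi>) = bform D (gradient D j) (phi_fin D \<phi>)"
proof -
  have "phi_hat D \<phi> = (\<Sum>i\<in>UNIV. (wscale (\<phi> i / of_real (symm D i)) (gradient D i),
      of_bool (i = None) * (\<phi> i / of_real (symm D i)), 0))"
    unfolding phi_hat_def ascoroot_def asroot_eq
    by (rule sum.cong) (simp_all add: awscale_def wscale_wscale)
  then have "phi_hat D \<phi> = (phi_fin D \<phi>, \<phi> None, 0)"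
    by (simp add: aweight_sum sum_wscale_gradient phi_fin_def symm_0 UNIV_option_sum)
  then show ?thesis
    by (simp add: asroot_eq aform_def)
qed

text \<open>Turns the exponential factors of the potential into plain shifts of the exponent
  \<open>\<beta>\<close>.\<close>

lemma wexp_diff_unit_exp:
  assumes "lam \<in> weights D" "0 < \<beta> i"
  shows "exp (- aform D (asroot D i) (phi_hat D \<phi>)) * wexp D lam \<phi> (\<beta> - unit_exp i) = wexp D lam \<phi> \<beta>"
  unfolding wexp_def aform_asroot_phi_hat exp_add[symmetric] cone_fin_diff_unit_exp[of \<beta> i, OF assms(2)]
  by (simp add: bform_diff bform_add diff_in_weights add_in_weights rho_in assms cone_fin_in
      gradient_in phi_fin_in diff_diff_eq)

text \<open>\<open>phi_fin\<close> is affine in \<open>\<phi>\<^sub>i\<close> with slope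
  \<open>\<alpha>\<^sub>i\<^sup>\<or>\<close>. The constant \<open>C\<close> allows a second
  application, for second derivatives.\<close>

lemma phi_deriv_exp:
  assumes "x \<in> weights D"
  shows "phi_deriv i (\<lambda>\<psi>. C * exp (bform D x (phi_fin D \<psi>))) \<phi> =
    C * bform D x (wscale (1 / of_real (symm D (Some i))) (sroot D i)) * exp (bform D x (phi_fin D \<phi>))"
proof -
  let ?p = "bform D x (wscale (1 / of_real (symm D (Some i))) (sroot D i))"
  have "phi_fin D (\<phi>(Some i := t)) = phi_fin D \<phi> +
      wscale (t - \<phi> (Some i)) (wscale (1 / of_real (symm D (Some i))) (sroot D i))" for t
  proof -
    have "wscale ((\<phi>(Some i := t)) (Some j) / of_real (symm D (Some j))) (sroot D j) =
        wscale (\<phi> (Some j) / of_real (symm D (Some j))) (sroot D j) +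
        (if j = i then wscale ((t - \<phi> (Some i)) * (1 / of_real (symm D (Some i)))) (sroot D i) else 0)" for j
      by (auto simp: wscale_def fun_eq_iff ring_distribs diff_divide_distrib)
    then show ?thesis
      by (simp add: phi_fin_def sum.distrib wscale_wscale)
  qed
  then have "bform D x (phi_fin D (\<phi>(Some i := t))) = bform D x (phi_fin D \<phi>) + (t - \<phi> (Some i)) * ?p" for t
    by (simp only: bform_add_right bform_scale_right assms phi_fin_in wscale_in_weights sroot_in)
  moreover have "((\<lambda>t. C * exp (bform D x (phi_fin D \<phi>) + (t - \<phi> (Some i)) * ?p)) has_field_derivative
      C * ?p * exp (bform D x (phi_fin D \<phi>))) (at (\<phi> (Some i)))"
    by (auto intro!: derivative_eq_intros)
  ultimately show ?thesis
    unfolding phi_deriv_def by (simp add: DERIV_imp_deriv)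
qed

text \<open>With \<open>wexp\<close> factored out the operator acts on the coefficients alone: each
  exponential is a Laplace eigenfunction, and the potential becomes a shift.\<close>

lemma toda_W_series:
  assumes "lam \<in> weights D"
  shows "toda D (W_series D lam w) \<phi> \<beta> =
    wexp D lam \<phi> \<beta> * ((E_eigen D lam - v_crit lam \<beta>) * w \<beta> + mps_shift_sum w \<beta>)"
proof -
  define x where "x = lam + rho D - cone_fin D \<beta>"
  define p where "p = (\<lambda>i. bform D x (wscale (1 / of_real (symm D (Some i))) (sroot D i)))"
  have x: "x \<in> weights D"
    unfolding x_def by (intro diff_in_weights add_in_weights assms rho_in cone_fin_in)
  have W: "(\<lambda>\<psi>. W_series D lam w \<psi> \<beta>) = (\<lambda>\<psi>. w \<beta> * exp (bform D x (phi_fin D \<psi>)))"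
    by (simp add: W_series_def wexp_def x_def mult.commute)
  have D1: "phi_deriv j (\<lambda>\<psi>. W_series D lam w \<psi> \<beta>) =
      (\<lambda>\<psi>. (w \<beta> * p j) * exp (bform D x (phi_fin D \<psi>)))" for j
    unfolding W using phi_deriv_exp[OF x] by (simp add: p_def fun_eq_iff)
  have D2: "phi_deriv i (phi_deriv j (\<lambda>\<psi>. W_series D lam w \<psi> \<beta>)) \<phi> =
      (p i * p j) * (w \<beta> * wexp D lam \<phi> \<beta>)" for i j
    unfolding D1 phi_deriv_exp[OF x] by (simp add: p_def wexp_def x_def)
  have "1/2 * (\<Sum>i\<in>UNIV. \<Sum>j\<in>UNIV. bform D (fweight D i) (fweight D j) *
      phi_deriv i (phi_deriv j (\<lambda>\<psi>. W_series D lam w \<psi> \<beta>)) \<phi>) =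
      1/2 * bform D x x * (w \<beta> * wexp D lam \<phi> \<beta>)"
    unfolding D2 bform_self_fweight[OF x]
    by (simp add: sum_distrib_right mult.assoc p_def)
  also have "1/2 * bform D x x = E_eigen D lam - v_crit lam \<beta>"
    unfolding x_def by (rule E_eigen_minus_v_crit[OF assms])
  finally have lap: "1/2 * (\<Sum>i\<in>UNIV. \<Sum>j\<in>UNIV. bform D (fweight D i) (fweight D j) *
      phi_deriv i (phi_deriv j (\<lambda>\<psi>. W_series D lam w \<psi> \<beta>)) \<phi>) =
      (E_eigen D lam - v_crit lam \<beta>) * (w \<beta> * wexp D lam \<phi> \<beta>)" .
  have sum_apply: "(\<Sum>j\<in>J. g j) \<beta> = (\<Sum>j\<in>J. g j \<beta>)"
    for J :: "'n option set" and g :: "'n option \<Rightarrow> ('n option, complex) mps"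
    by (induction J rule: infinite_finite_induct) auto
  have "(\<Sum>j\<in>UNIV. mps_mult (mps_monom (unit_exp j) (exp (- aform D (asroot D j) (phi_hat D \<phi>))))
      (W_series D lam w \<phi>)) \<beta> = (\<Sum>j | 0 < \<beta> j. wexp D lam \<phi> \<beta> * w (\<beta> - unit_exp j))"
    unfolding sum_apply mps_mult_monom_left unit_exp_le_iff
    using wexp_diff_unit_exp[OF assms, of \<beta> _ \<phi>]
    by (simp add: sum.If_cases W_series_def flip: mult.assoc)
  also have "\<dots> = wexp D lam \<phi> \<beta> * mps_shift_sum w \<beta>"
    by (simp add: mps_shift_sum_eq sum_distrib_left)
  finally show ?thesis
    unfolding toda_def plus_fun_apply lap by (simp add: algebra_simps)
qed

text \<open>\<open>wexp\<close> depends on \<open>\<beta>\<close> only through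
  \<open>cone_fin\<close>, which ignores multiples of \<open>\<delta>\<close>.\<close>

lemma mult_W_series:
  assumes "on_ray (mark D) F"
  shows "mps_mult F (W_series D lam w \<phi>) \<beta> = wexp D lam \<phi> \<beta> * mps_mult F w \<beta>"
  unfolding W_series_def
  using assms by (rule on_ray_mult_invariant) (simp add: wexp_def cone_fin_add_ray)

lemma F_series_eq:
  assumes "on_ray (mark D) F" "F 0 = 0"
  shows "F_series D (\<lambda>m. F (\<lambda>i. m * mark D i)) = F"
proof
  fix \<beta>
  \<comment> \<open>Since \<open>a\<^sub>0 = 1\<close>, the exponent \<open>\<beta>\<close>
    determines \<open>m\<close>.\<close>
  have None: "m = \<beta> None" if "\<beta> = (\<lambda>i. m * mark D i)" for m
    using that by (simp add: mark_0)
  show "F_series D (\<lambda>m. F (\<lambda>i. m * mark D i)) \<beta> = F \<beta>"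
  proof (cases "F \<beta> = 0")
    case True
    then show ?thesis
      by (auto simp: F_series_def intro!: sum.neutral)
  next
    case False
    then obtain n where n: "\<beta> = (\<lambda>i. n * mark D i)"
      using assms(1) by (auto simp: on_ray_def)
    have "n \<noteq> 0"
      using False n assms(2) by (cases n) (auto simp: zero_fun_def)
    moreover have "m = n" if "\<beta> = (\<lambda>i. m * mark D i)" for m
      using None[OF that] None[OF n] by simp
    ultimately have "{m. 1 \<le> m \<and> \<beta> = (\<lambda>i. m * mark D i)} \<subseteq> {n}"
      by blast
    moreover have "n \<in> {m. 1 \<le> m \<and> \<beta> = (\<lambda>i. m * mark D i)}"
      using n \<open>n \<noteq> 0\<close> by simp
    ultimately have "{m. 1 \<le> m \<and> \<beta> = (\<lambda>i. m * mark D i)} = {n}"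
      by blast
    then show ?thesis
      unfolding F_series_def using n by simp
  qed
qed

lemma E_tilde_mult_W_series:
  assumes "on_ray (mark D) (F_series D f)"
  shows "mps_mult (E_tilde D lam f) (W_series D lam w \<phi>) \<beta> =
    wexp D lam \<phi> \<beta> * (E_eigen D lam * w \<beta> + mps_mult (mps_euler None (F_series D f)) w \<beta>)"
proof -
  have "on_ray (mark D) (mps_euler None (F_series D f))"
    using assms by (auto simp: on_ray_def mps_euler_def)
  moreover have "0 \<le> \<beta>"
    by (simp add: le_fun_def)
  moreover have "W_series D lam w \<phi> \<beta> = wexp D lam \<phi> \<beta> * w \<beta>"
    by (simp add: W_series_def)
  ultimately show ?thesis
    by (simp add: E_tilde_def mps_mult_add_left mult_W_series mps_mult_monom_left ring_distribs)
qed

lemma whittaker_laurent_expansion: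
  fixes V :: "('n option, complex fls) mps"
  assumes "lam \<in> weights D" "generic D lam" "V 0 = 1"
    and "\<And>\<beta>. (fls_const (v_crit lam \<beta>) + of_nat (\<beta> None) * fls_X) * V \<beta> = mps_shift_sum V \<beta>"
  shows "(\<lambda>\<epsilon>. whittaker D lam (\<epsilon> - of_real (dual_coxeter D)) \<phi> \<beta>)
    has_laurent_expansion fls_const (wexp D lam \<phi> \<beta>) * V \<beta>"
proof -
  have "fls_const (v_crit lam \<gamma>) + of_nat (\<gamma> None) * fls_X \<noteq> 0" (is "?d \<noteq> 0") if "\<gamma> \<noteq> 0" for \<gamma>
  proof
    assume d: "?d = 0"
    \<comment> \<open>Both coefficients vanish only for \<open>\<gamma> = n \<delta>\<close> with
      \<open>n = \<gamma>\<^sub>0 = 0\<close>.\<close>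
    have "fls_nth ?d 0 = v_crit lam \<gamma>" "fls_nth ?d 1 = of_nat (\<gamma> None)"
      by (simp_all add: fls_of_nat)
    with d have "v_crit lam \<gamma> = 0" "\<gamma> None = 0"
      by simp_all
    then have "\<gamma> = 0"
      by (auto simp: v_crit_eq_0_iff assms mark_0 fun_eq_iff)
    with that show False by simp
  qed
  then have "(\<lambda>\<epsilon>. \<Sum>p\<in>root_paths \<beta>. \<Prod>k\<in>{1..<length p}. 1 / (v_crit lam (p ! k) + of_nat ((p ! k) None) * \<epsilon>))
      has_laurent_expansion V \<beta>"
    by (rule laurent_expansion_sum_root_paths[where V = V, OF assms(3)]) (simp_all add: assms(4))
  then show ?thesis
    unfolding whittaker_def Z_coeff_def v_hat_eq
      mult.commute[of "fls_const (wexp D lam \<phi> \<beta>)" "V \<beta>"]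
    by (rule has_laurent_expansion_cmult_right)
qed

end

theorem theorem5p3:
  fixes D :: "('g::ab_group_add, 'n::finite) affine_data"
    and lam :: "'g weight"
  assumes "affine_data D"
    and "lam \<in> weights D"
    and "generic D lam"
  shows "\<exists>(f :: nat \<Rightarrow> complex) (w :: nat \<Rightarrow> ('n option \<Rightarrow> nat) \<Rightarrow> complex).
    (\<forall>\<phi> \<beta>. (\<lambda>\<epsilon>. whittaker D lam (\<epsilon> - of_real (dual_coxeter D)) \<phi> \<beta>) has_laurent_expansion
       mps_mult (mps_exp (div_eps (F_series D f))) (eps_series (\<lambda>j. W_series D lam (w j) \<phi>)) \<beta>) \<and>
    (\<forall>\<phi>. toda D (W_series D lam (w 0)) \<phi> = mps_mult (E_tilde D lam f) (W_series D lam (w 0) \<phi>)) \<and>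
    (\<forall>j\<ge>1. \<forall>\<phi>. toda D (W_series D lam (w j)) \<phi> - mps_mult (E_tilde D lam f) (W_series D lam (w j) \<phi>)
       = mps_euler None (W_series D lam (w (j - 1)) \<phi>))"
proof -
  interpret affine_data D by fact
  let ?c = "v_crit lam"
  obtain W :: "('n option, complex fps) mps" and F :: "('n option, complex) mps"
    where W0: "W 0 = 1" and F0: "F 0 = 0" and F: "on_ray (mark D) F"
      and W: "\<And>\<beta>. (fps_const (?c \<beta>) + of_nat (\<beta> None) * fps_X) * W \<beta>
        + mps_mult (\<lambda>\<gamma>. fps_const (of_nat (\<gamma> None) * F \<gamma>)) W \<beta> = mps_shift_sum W \<beta>"
    by (rule ex_regular_solution[of "mark D" None ?c, OF mark_0 v_crit_eq_0_iff[OF assms(2,3)]]) (rule that)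
  \<comment> \<open>\<open>f m\<close> is the coefficient of \<open>F\<close> at
    \<open>m \<delta>\<close>, and \<open>w j\<close> collects the coefficients of
    \<open>\<epsilon>\<^sup>j\<close> in the regular solution.\<close>
  define f where "f = (\<lambda>m. F (\<lambda>i. m * mark D i))"
  define w where "w = (\<lambda>j \<beta>. W \<beta> $ j)"
  have f: "F_series D f = F"
    unfolding f_def by (rule F_series_eq[OF F F0])
  define E where "E = mps_exp (div_eps F)"
  define V where "V = mps_mult E (\<lambda>\<beta>. fps_to_fls (W \<beta>))"
  have E: "on_ray (mark D) E"
    unfolding E_def by (rule on_ray_exp_div_eps[OF F])
  have "V 0 = 1"
    by (simp add: V_def E_def mps_mult_zero_exp W0 mps_exp_def mps_monom_def)
  moreover have "(fls_const (?c \<beta>) + of_nat (\<beta> None) * fls_X) * V \<beta> = mps_shift_sum V \<beta>" for \<beta>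
    unfolding V_def E_def using F0 F _ W
    by (rule exp_mult_regular_solution) (simp add: v_crit_def cone_fin_add_ray)
  ultimately have whittaker: "(\<lambda>\<epsilon>. whittaker D lam (\<epsilon> - of_real (dual_coxeter D)) \<phi> \<beta>)
      has_laurent_expansion fls_const (wexp D lam \<phi> \<beta>) * V \<beta>" for \<phi> \<beta>
    by (rule whittaker_laurent_expansion[OF assms(2,3)])
  \<comment> \<open>\<open>wexp\<close> is constant along the ray and so moves out of the product
    with \<open>E\<close>.\<close>
  have eps: "mps_mult E (eps_series (\<lambda>j. W_series D lam (w j) \<phi>)) \<beta> = fls_const (wexp D lam \<phi> \<beta>) * V \<beta>"
    for \<phi> \<beta>
  proof -
    have "Abs_fps (\<lambda>j. wexp D lam \<phi> \<gamma> * W \<gamma> $ j) = fps_const (wexp D lam \<phi> \<gamma>) * W \<gamma>" for \<gamma>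
      by (rule fps_ext) simp
    then have "eps_series (\<lambda>j. W_series D lam (w j) \<phi>) =
        (\<lambda>\<gamma>. fls_const (wexp D lam \<phi> \<gamma>) * fps_to_fls (W \<gamma>))"
      by (simp add: eps_series_def W_series_def w_def fls_times_fps_to_fls)
    then show ?thesis
      unfolding V_def
      using on_ray_mult_invariant[OF E, of "\<lambda>\<gamma>. fls_const (wexp D lam \<phi> \<gamma>)"]
      by (simp add: wexp_def cone_fin_add_ray)
  qed
  \<comment> \<open>The coefficient of \<open>\<epsilon>\<^sup>j\<close> in the equation for
    \<open>W\<close>: the term with \<open>\<epsilon> \<beta>\<^sub>0\<close> brings in
    \<open>w (j - 1)\<close>, and nothing for \<open>j = 0\<close>.\<close>
  have coeff: "?c \<beta> * w j \<beta> + (if j = 0 then 0 else of_nat (\<beta> None) * w (j - 1) \<beta>)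
      + mps_mult (mps_euler None F) (w j) \<beta> = mps_shift_sum (w j) \<beta>" for j \<beta>
    using arg_cong[OF W[of \<beta>], of "\<lambda>x. x $ j"]
    by (cases "j = 0")
      (simp_all add: distrib_right mult.assoc mps_mult_def mps_euler_def mps_shift_sum_eq fps_sum_nth
        w_def flip: fps_of_nat)
  \<comment> \<open>The case \<open>j = 0\<close> is the eigenvalue equation,
    \<open>j \<ge> 1\<close> the inhomogeneous one.\<close>
  have toda: "toda D (W_series D lam (w j)) \<phi> \<beta> - mps_mult (E_tilde D lam f) (W_series D lam (w j) \<phi>) \<beta>
      = wexp D lam \<phi> \<beta> * (if j = 0 then 0 else of_nat (\<beta> None) * w (j - 1) \<beta>)" for j \<phi> \<beta>
    using F unfolding toda_W_series[OF assms(2)] coeff[symmetric] f[symmetric]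
    by (subst E_tilde_mult_W_series) (simp_all add: algebra_simps)
  show ?thesis
  proof (intro exI[of _ f] exI[of _ w] conjI allI impI)
    show "(\<lambda>\<epsilon>. whittaker D lam (\<epsilon> - of_real (dual_coxeter D)) \<phi> \<beta>) has_laurent_expansion
       mps_mult (mps_exp (div_eps (F_series D f))) (eps_series (\<lambda>j. W_series D lam (w j) \<phi>)) \<beta>" for \<phi> \<beta>
      using whittaker eps by (simp add: f E_def)
    show "toda D (W_series D lam (w 0)) \<phi> = mps_mult (E_tilde D lam f) (W_series D lam (w 0) \<phi>)" for \<phi>
      using toda[of 0 \<phi>] by (simp add: fun_eq_iff)
    show "toda D (W_series D lam (w j)) \<phi> - mps_mult (E_tilde D lam f) (W_series D lam (w j) \<phi>)
       = mps_euler None (W_series D lam (w (j - 1)) \<phi>)" if "j \<ge> 1" for j \<phi>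
      using toda[of j \<phi>] that by (simp add: fun_eq_iff mps_euler_def W_series_def)
  qed
qed

end
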